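(* Let $f:\mathbb R^{m\times n}\to\mathbb R$ be differentiable, with $m\ge n$, and assume: (1) $f(\mathbf X)\ge f^\star>-\infty$ for all $\mathbf X$; (2) $\|\nabla f(\mathbf Y)-\nabla f(\mathbf X)\|_F\le L\|\mathbf Y-\mathbf X\|_F$ for all $\mathbf X,\mathbf Y$, where $L>0$; (3) there is $\sigma>0$ such that for all $\mathbf X$, $\mathbb E[\nabla f(\mathbf X;\xi)]=\nabla f(\mathbf X)$ and $\mathbb E\|\nabla f(\mathbf X;\xi)-\nabla f(\mathbf X)\|_F^2\le\sigma^2$. Let $\eta_t=t^{-3/4}$, $\beta_t=1-t^{-1/2}$, $a:=0.2\sqrt{\max\{m,n\}}$, and let the iterates be generated, for $t\ge1$, from $\mathbf M_0=\mathbf 0$ and an initial point $\mathbf X_1$ by $$\mathbf G_t=\nabla f(\mathbf X_t;\xi_t),\quad \mathbf M_t=\beta_t\mathbf M_{t-1}+(1-\beta_t)\mathbf G_t,\quad \mathbf O_t=\operatorname{Orth}\bigl(\mathbf D_{r,t}^{-1/2}\mathbf M_t\mathbf D_{c,t}^{-1/2}\bigr),\quad \mathbf X_{t+1}=\mathbf X_t-a\eta_t\mathbf O_t,$$ where $\mathbf D_{r,t}=\operatorname{diag}(\operatorname{rowsum}(\mathbf M_t\odot\mathbf M_t)+\varepsilon)$ and $\mathbf D_{c,t}=\operatorname{diag}(\operatorname{colsum}(\mathbf M_t\odot\mathbf M_t)+\varepsilon)$. Assume there is $G_\infty>0$ with $\|\mathbf G_t\|_\infty\le G_\infty$ almost surely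 for all $t$, and that $\varepsilon\ge\frac45G_\infty^2\max\{m,n\}$. Define $$\rho_r:=\sqrt{1+\tfrac{nG_\infty^2}{\varepsilon}},\quad \rho_c:=\sqrt{1+\tfrac{mG_\infty^2}{\varepsilon}},\quad \chi_\varepsilon:=\frac{(\rho_r+1)(\rho_c+1)}{4\rho_r\rho_c}-\frac{3\rho_r\rho_c-\rho_r-\rho_c-1}{4}.$$ Then $\rho_r,\rho_c\le 3/2$, hence $\chi_\varepsilon\ge 1/144$, and consequently, for every $T\ge1$, $$\frac1T\sum_{t=1}^T\mathbb E\|\nabla f(\mathbf X_t)\|_F\le\frac{f(\mathbf X_1)-f^\star+C_1(1+\ln T)+C_2}{a\,\chi_\varepsilon\,T^{1/4}},$$ where $$C_1=\frac aL\bigl(2\sqrt2\,L^2a^2n+\sigma^2\bigr)+aL\bigl(\chi_\varepsilon+\rho_r\rho_c\sqrt n\bigr)^2,\qquad C_2=\frac{a\sigma^2}{L}+\frac{3La^2n}{2}.$$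
   Context: $f(\mathbf X)=\mathbb E_{\xi\sim\mathcal D}[f(\mathbf X;\xi)]$ is a possibly nonconvex stochastic objective; $\xi_1,\xi_2,\dots$ are i.i.d. samples from $\mathcal D$ ($\xi_t$ is independent of $\mathbf X_1,\dots,\mathbf X_t$ and $\mathbf M_{t-1}$), and $\mathbf X_1$ is deterministic. For a nonzero matrix with compact SVD $\mathbf A=\mathbf U\Sigma\mathbf V^\top$, $\operatorname{Orth}(\mathbf A):=\mathbf U\mathbf V^\top$; $\operatorname{Orth}(\mathbf 0):=\mathbf 0$. $\odot$ is the entrywise product; $\operatorname{rowsum}(\mathbf A)\in\mathbb R^m$ and $\operatorname{colsum}(\mathbf A)\in\mathbb R^n$ are the vectors of row sums and column sums; $\varepsilon$ is added to every entry. $\|\cdot\|_F$ is the Frobenius norm and $\|\cdot\|_\infty$ the maximum absolute entry. *)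

theory Defs
  imports "HOL-Probability.Probability"
begin

text \<open>
  An $m \times n$ real matrix is an element of \<^typ>\<open>real ^ 'n ^ 'm\<close> with $m$ = \<open>CARD('m)\<close> and
  $n$ = \<open>CARD('n)\<close>. On this type the library's inner product and \<^const>\<open>norm\<close> are the Frobenius
  ones, \<^const>\<open>infnorm\<close> is the maximum absolute entry, and \<open>*\<close> is the entrywise product (the
  matrix product is \<open>**\<close>).
\<close>

text \<open>The gradient for the ambient inner product; meaningful where \<open>f\<close> is differentiable.\<close>

definition grad :: "('a::real_inner \<Rightarrow> real) \<Rightarrow> 'a \<Rightarrow> 'a"
  where "grad f x = (THE D. GDERIV f x :> D)"

definition outer :: "real ^ 'm \<Rightarrow> real ^ 'n \<Rightarrow> real ^ 'n ^ 'm"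
  where "outer u v = (\<chi> i j. u $ i * v $ j)"

text \<open>
  Compact SVD $A = U \Sigma V^\top$ of rank \<open>r\<close>. Since \<open>r\<close> depends on \<open>A\<close> and cannot be a type
  index, \<open>U\<close> and \<open>V\<close> are given by their columns \<open>u 0, \<dots>, u (r - 1)\<close> and \<open>v 0, \<dots>, v (r - 1)\<close>, and
  \<open>\<Sigma>\<close> by its positive diagonal \<open>s 0, \<dots>, s (r - 1)\<close>.
\<close>

definition compact_svd ::
    "real ^ 'n ^ 'm \<Rightarrow> nat \<Rightarrow> (nat \<Rightarrow> real ^ 'm) \<Rightarrow> (nat \<Rightarrow> real) \<Rightarrow> (nat \<Rightarrow> real ^ 'n) \<Rightarrow> bool"
  where "compact_svd A r u s v \<longleftrightarrow>
    (\<forall>i<r. \<forall>j<r. u i \<bullet> u j = (if i = j then 1 else 0)) \<and>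
    (\<forall>i<r. \<forall>j<r. v i \<bullet> v j = (if i = j then 1 else 0)) \<and>
    (\<forall>i<r. 0 < s i) \<and>
    A = (\<Sum>i<r. s i *\<^sub>R outer (u i) (v i))"

text \<open>
  $U V^\top$ for any compact SVD of \<open>A\<close>; the product does not depend on the decomposition chosen.
\<close>

definition Orth :: "real ^ 'n ^ 'm \<Rightarrow> real ^ 'n ^ 'm"
  where "Orth A =
    (if A = 0 then 0
     else (THE Q. \<exists>r u s v. compact_svd A r u s v \<and> Q = (\<Sum>i<r. outer (u i) (v i))))"

definition rowsum :: "real ^ 'n ^ 'm \<Rightarrow> real ^ 'm"
  where "rowsum A = (\<chi> i. \<Sum>j\<in>UNIV. A $ i $ j)"

definition colsum :: "real ^ 'n ^ 'm \<Rightarrow> real ^ 'n"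
  where "colsum A = (\<chi> j. \<Sum>i\<in>UNIV. A $ i $ j)"

definition diag :: "real ^ 'k \<Rightarrow> real ^ 'k ^ 'k"
  where "diag d = (\<chi> i j. if i = j then d $ i else 0)"

text \<open>$D^{-1/2}$ for a diagonal matrix \<open>D\<close> with positive diagonal; off-diagonal entries are ignored.\<close>

definition diag_inv_sqrt :: "real ^ 'k ^ 'k \<Rightarrow> real ^ 'k ^ 'k"
  where "diag_inv_sqrt D = diag (\<chi> i. (D $ i $ i) powr (- 1 / 2))"

definition D_row :: "real \<Rightarrow> real ^ 'n ^ 'm \<Rightarrow> real ^ 'm ^ 'm"
  where "D_row \<epsilon> M = diag (rowsum (M * M) + vec \<epsilon>)"

definition D_col :: "real \<Rightarrow> real ^ 'n ^ 'm \<Rightarrow> real ^ 'n ^ 'n"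
  where "D_col \<epsilon> M = diag (colsum (M * M) + vec \<epsilon>)"

end

theory Submission
  imports Defs
begin

text \<open>
  With \<open>O = Orth (precondition \<epsilon> M)\<close>, the diagonal scalings have entries in \<open>sqrt \<epsilon> \<cdot> [1, \<rho>\<^sub>r]\<close>
  and \<open>sqrt \<epsilon> \<cdot> [1, \<rho>\<^sub>c]\<close>, so that \<open>O\<close> is still aligned with \<open>M\<close>:
  \<open>M \<bullet> O \<ge> \<chi>\<^sub>\<epsilon> \<parallel>M\<parallel>\<close>. Hence the descent lemma decreases \<open>f\<close> by
  \<open>a \<eta>\<^sub>t \<chi>\<^sub>\<epsilon> \<parallel>\<nabla>f(X\<^sub>t)\<parallel>\<close> up to multiples of \<open>\<eta>\<^sub>t \<parallel>E\<^sub>t\<parallel>\<close> and \<open>\<eta>\<^sub>t\<^sup>2\<close>, where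
  \<open>E\<^sub>t = M\<^sub>t - \<nabla>f(X\<^sub>t)\<close>. Since the gradient noise at time \<open>t\<close> is centred given the past,
  \<open>\<bbbE> \<parallel>E\<^sub>t\<parallel>\<^sup>2\<close> contracts by \<open>1 - t\<^bsup>-1/2\<^esup>\<close> up to an error of order \<open>1/t\<close>. Telescoping
  bounds the sum of \<open>t\<^bsup>-1/2\<^esup> \<bbbE> \<parallel>E\<^sub>t\<parallel>\<^sup>2\<close> logarithmically, and Young's inequality splits
  \<open>\<eta>\<^sub>t \<parallel>E\<^sub>t\<parallel>\<close> into such a term and one of order \<open>1/t\<close>.
\<close>

section \<open>Gradients\<close>

text \<open>Two objects of the iteration resist measure theory: \<open>grad\<close> is a definite
  description, and \<open>Orth\<close> jumps where the rank changes. Both are exhibited as pointwise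
  limits, of difference quotients and of Newton-Schulz iterates. Conditioning on the past needs no
  conditional expectations: \<open>X t\<close> and \<open>M (t - 1)\<close> are Borel functions of
  the finite sample history, that history is independent of \<open>\<xi> t\<close>, and Fubini does
  the rest. The almost sure bound on the samples serves twice. Being a convex condition, it passes
  to the momentum and so confines its row and column sums; and it makes the error terms at each time
  bounded, which settles integrability. The factor 4/5 gives 1 + 5/4 = (3/2)^2, hence the bound 3/2
  on \<open>\<rho>\<^sub>r\<close> and \<open>\<rho>\<^sub>c\<close>; there the two terms of
  \<open>\<chi>\<^sub>\<epsilon>\<close> are 25/36 and 11/16, whose difference is 1/144. The
  exponents 3/4 and 1/2 give the squared drift divided by \<open>1 - \<beta> t\<close>, the sampling
  noise and the Young remainder the same order 1/t.\<close>

lemma gderiv_grad: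
  fixes f :: "'a::euclidean_space \<Rightarrow> real"
  assumes "f differentiable (at x)"
  shows "GDERIV f x :> grad f x"
proof -
  obtain f' where f': "(f has_derivative f') (at x)"
    using assms by (auto simp: differentiable_def)
  interpret f': linear f' using f' by (rule has_derivative_linear)
  have "f' = (\<lambda>h. h \<bullet> (\<Sum>b\<in>Basis. f' b *\<^sub>R b))"
  proof
    fix h
    have "f' h = f' (\<Sum>b\<in>Basis. (h \<bullet> b) *\<^sub>R b)"
      by (simp add: euclidean_representation)
    also have "\<dots> = (\<Sum>b\<in>Basis. (h \<bullet> b) * f' b)"
      by (simp add: f'.sum f'.scaleR)
    finally show "f' h = h \<bullet> (\<Sum>b\<in>Basis. f' b *\<^sub>R b)"
      by (simp add: inner_sum_right mult.commute)
  qed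
  then have ex: "GDERIV f x :> (\<Sum>b\<in>Basis. f' b *\<^sub>R b)"
    using f' by (simp add: gderiv_def)
  have uniq: "D = D'" if "GDERIV f x :> D" "GDERIV f x :> D'" for D D'
  proof -
    have "(\<lambda>h. h \<bullet> D) = (\<lambda>h. h \<bullet> D')"
      using that by (auto simp: gderiv_def intro: has_derivative_unique)
    then have "h \<bullet> D = h \<bullet> D'" for h
      by (rule fun_cong)
    then show ?thesis
      using vector_eq_ldot by blast
  qed
  show ?thesis
    unfolding grad_def by (rule theI[where P = "\<lambda>D. GDERIV f x :> D"]) (fact ex, rule uniq[OF _ ex])
qed

lemma has_derivative_grad:
  fixes f :: "'a::euclidean_space \<Rightarrow> real"
  assumes "f differentiable (at x)"
  shows "(f has_derivative (\<lambda>h. h \<bullet> grad f x)) (at x)"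
  using gderiv_grad[OF assms] by (simp add: gderiv_def)

lemma has_real_derivative_along_line:
  fixes f :: "'a::euclidean_space \<Rightarrow> real"
  assumes "f differentiable (at (x + s *\<^sub>R d))"
  shows "((\<lambda>s. f (x + s *\<^sub>R d)) has_real_derivative (d \<bullet> grad f (x + s *\<^sub>R d))) (at s)"
proof -
  have "((\<lambda>s. x + s *\<^sub>R d) has_derivative (\<lambda>h. h *\<^sub>R d)) (at s)"
    by (auto intro!: derivative_eq_intros)
  from has_derivative_compose[OF this has_derivative_grad[OF assms]] show ?thesis
    by (simp add: has_field_derivative_def mult.commute[of _ "d \<bullet> _"])
qed

text \<open>Along the segment, \<open>f\<close> minus the claimed quadratic bound has nonpositive
  derivative, by Cauchy-Schwarz and the Lipschitz condition. Comparing the endpoints then suffices,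
  and no gradient has to be integrated.\<close>

lemma descent_lemma:
  fixes f :: "'a::euclidean_space \<Rightarrow> real"
  assumes diff: "\<And>x. f differentiable (at x)"
    and lip: "\<And>x y. norm (grad f y - grad f x) \<le> L * norm (y - x)"
  shows "f y \<le> f x + grad f x \<bullet> (y - x) + L / 2 * (norm (y - x))\<^sup>2"
proof -
  define d where "d = y - x"
  define \<phi> where "\<phi> s = f (x + s *\<^sub>R d) - s * (grad f x \<bullet> d) - L / 2 * s\<^sup>2 * (norm d)\<^sup>2" for s
  have "\<phi> 1 \<le> \<phi> 0"
  proof (rule DERIV_nonpos_imp_nonincreasing[where f = \<phi>])
    fix s :: real assume s: "0 \<le> s" "s \<le> 1"
    have deriv: "(\<phi> has_real_derivative
        d \<bullet> grad f (x + s *\<^sub>R d) - grad f x \<bullet> d - L * s * (norm d)\<^sup>2) (at s)"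
      unfolding \<phi>_def
      by (rule derivative_eq_intros has_real_derivative_along_line diff refl)+ simp
    have "(grad f (x + s *\<^sub>R d) - grad f x) \<bullet> d \<le> norm (grad f (x + s *\<^sub>R d) - grad f x) * norm d"
      by (rule norm_cauchy_schwarz)
    also have "\<dots> \<le> (L * norm (x + s *\<^sub>R d - x)) * norm d"
      by (intro mult_right_mono lip) auto
    also have "\<dots> = L * s * (norm d)\<^sup>2"
      using s by (simp add: power2_eq_square)
    finally have "d \<bullet> grad f (x + s *\<^sub>R d) - grad f x \<bullet> d - L * s * (norm d)\<^sup>2 \<le> 0"
      by (simp add: inner_diff_left inner_commute[of d])
    with deriv show "\<exists>y. DERIV \<phi> s :> y \<and> y \<le> 0"
      by blast
  qed simp
  then show ?thesis
    by (simp add: \<phi>_def d_def)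
qed

text \<open>A fixed countable sequence of increments recovers the directional derivatives; this lets
  measurability in a parameter pass to \<open>grad\<close>.\<close>

lemma grad_inner_LIMSEQ:
  fixes f :: "'a::euclidean_space \<Rightarrow> real"
  assumes "f differentiable (at x)"
  shows "(\<lambda>k. (f (x + (1 / real (Suc k)) *\<^sub>R b) - f x) * real (Suc k)) \<longlonglongrightarrow> grad f x \<bullet> b"
proof -
  have "((\<lambda>s. f (x + s *\<^sub>R b)) has_real_derivative (b \<bullet> grad f (x + 0 *\<^sub>R b))) (at 0)"
    by (rule has_real_derivative_along_line) (use assms in simp)
  then have lim: "(\<lambda>h. (f (x + h *\<^sub>R b) - f x) / h) \<midarrow>0\<rightarrow> b \<bullet> grad f x"
    by (simp add: DERIV_def)
  have "filterlim (\<lambda>k. 1 / real (Suc k)) (at 0) sequentially"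
    using LIMSEQ_inverse_real_of_nat by (auto simp: filterlim_at inverse_eq_divide)
  from filterlim_compose[OF lim this] show ?thesis
    by (simp add: inner_commute)
qed

text \<open>Replacing the first argument by a simple function leaves finitely many sections
  \<open>F y\<close>, each measurable in \<open>z\<close>; continuity in \<open>y\<close> passes
  measurability on to the limit.\<close>

lemma borel_measurable_Caratheodory:
  fixes F :: "'a::{second_countable_topology, metric_space} \<Rightarrow> 's \<Rightarrow> 'b::metric_space"
  assumes meas: "\<And>y. F y \<in> borel_measurable D"
    and cont: "\<And>z. z \<in> space D \<Longrightarrow> continuous_on UNIV (\<lambda>y. F y z)"
  shows "(\<lambda>(y, z). F y z) \<in> borel_measurable (borel \<Otimes>\<^sub>M D)"
proof -
  have id: "(\<lambda>x. x) \<in> borel_measurable (borel :: 'a measure)"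
    by simp
  \<comment> \<open>\<open>undefined\<close> only instantiates the base point of the growth bound
    that accompanies the approximating sequence.\<close>
  obtain S where S: "\<And>i. simple_function borel (S i)" "\<And>x :: 'a. (\<lambda>i. S i x) \<longlonglongrightarrow> x"
    using borel_measurable_implies_sequence_metric[OF id, of undefined] by auto
  show ?thesis
  proof (rule borel_measurable_LIMSEQ_metric)
    fix i
    have "(\<lambda>p. F (S i (fst p)) (snd p)) \<in> borel_measurable (borel \<Otimes>\<^sub>M D)"
    proof (rule measurable_compose_countable'[where I = "range (S i)"])
      show "countable (range (S i))"
        using S(1)[of i] by (auto simp: simple_function_def intro: countable_finite)
      have "S i \<in> measurable borel (count_space (range (S i)))"
        using S(1)[of i] by (auto simp: simple_function_eq_measurable measurable_def)
      then show "(\<lambda>p. S i (fst p)) \<in> measurable (borel \<Otimes>\<^sub>M D) (count_space (range (S i)))"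
        by (rule measurable_compose[OF measurable_fst])
      show "(\<lambda>p. F y (snd p)) \<in> borel_measurable (borel \<Otimes>\<^sub>M D)" for y
        by (rule measurable_compose[OF measurable_snd meas])
    qed
    then show "(\<lambda>(y, z). F (S i y) z) \<in> borel_measurable (borel \<Otimes>\<^sub>M D)"
      by (simp add: case_prod_beta')
  next
    fix p :: "'a \<times> 's" assume "p \<in> space (borel \<Otimes>\<^sub>M D)"
    then have "snd p \<in> space D"
      by (auto simp: space_pair_measure)
    from continuous_on_tendsto_compose[OF cont[OF this] S(2)]
    show "(\<lambda>i. case p of (y, z) \<Rightarrow> F (S i y) z) \<longlonglongrightarrow> (case p of (y, z) \<Rightarrow> F y z)"
      by (simp add: case_prod_beta')
  qed
qed

text \<open>Differentiability in \<open>y\<close> makes \<open>F\<close> continuous there, hence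
  jointly measurable; each directional derivative is then a limit of jointly measurable
  quotients.\<close>

lemma borel_measurable_grad_pair:
  fixes F :: "'a::euclidean_space \<Rightarrow> 's \<Rightarrow> real"
  assumes meas: "\<And>y. F y \<in> borel_measurable D"
    and diff: "\<And>y z. z \<in> space D \<Longrightarrow> (\<lambda>y'. F y' z) differentiable (at y)"
  shows "(\<lambda>(y, z). grad (\<lambda>y'. F y' z) y) \<in> borel_measurable (borel \<Otimes>\<^sub>M D)"
proof -
  have F [measurable]: "(\<lambda>(y, z). F y z) \<in> borel_measurable (borel \<Otimes>\<^sub>M D)"
    using meas
  proof (rule borel_measurable_Caratheodory)
    show "continuous_on UNIV (\<lambda>y. F y z)" if "z \<in> space D" for z
      using diff[OF that]
      by (simp add: continuous_at_imp_continuous_on differentiable_imp_continuous_within)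
  qed
  have *: "(\<lambda>p. grad (\<lambda>y'. F y' (snd p)) (fst p) \<bullet> b) \<in> borel_measurable (borel \<Otimes>\<^sub>M D)" for b
  proof (rule borel_measurable_LIMSEQ_metric)
    fix k
    show "(\<lambda>p. (F (fst p + (1 / real (Suc k)) *\<^sub>R b) (snd p) - F (fst p) (snd p)) * real (Suc k))
        \<in> borel_measurable (borel \<Otimes>\<^sub>M D)"
    proof -
      have "(\<lambda>p. (\<lambda>(y, z). F y z) (fst p + (1 / real (Suc k)) *\<^sub>R b, snd p))
          \<in> borel_measurable (borel \<Otimes>\<^sub>M D)"
        by measurable
      moreover have "(\<lambda>p. (\<lambda>(y, z). F y z) (fst p, snd p)) \<in> borel_measurable (borel \<Otimes>\<^sub>M D)"
        by measurable
      ultimately show ?thesis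
        by simp
    qed
  next
    fix p :: "'a \<times> 's" assume "p \<in> space (borel \<Otimes>\<^sub>M D)"
    then have "snd p \<in> space D"
      by (auto simp: space_pair_measure)
    then show "(\<lambda>k. (F (fst p + (1 / real (Suc k)) *\<^sub>R b) (snd p) - F (fst p) (snd p)) * real (Suc k))
        \<longlonglongrightarrow> grad (\<lambda>y'. F y' (snd p)) (fst p) \<bullet> b"
      using grad_inner_LIMSEQ[OF diff] by blast
  qed
  have "(\<lambda>p. grad (\<lambda>y'. F y' (snd p)) (fst p)) \<in> borel_measurable (borel \<Otimes>\<^sub>M D)"
    using * by (subst borel_measurable_euclidean_space) blast
  then show ?thesis
    by (simp add: case_prod_beta')
qed

section \<open>Singular value decomposition\<close>

lemma outer_mult_vec: "outer u v *v x = (v \<bullet> x) *\<^sub>R u"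
  by (simp add: outer_def matrix_vector_mult_def inner_vec_def vec_eq_iff sum_distrib_left
      mult_ac)

lemma transpose_outer: "transpose (outer u v) = outer v u"
  by (simp add: outer_def transpose_def vec_eq_iff)

lemma inner_outer: "A \<bullet> outer u v = u \<bullet> (A *v v)"
  by (simp add: outer_def matrix_vector_mult_def inner_vec_def sum_distrib_left mult_ac)

lemma norm_outer: "norm (outer u v) = norm u * norm v"
  by (simp add: norm_eq_sqrt_inner inner_outer outer_mult_vec real_sqrt_mult mult.commute)

lemma matrix_vector_mult_sum: "(\<Sum>i\<in>I. A i) *v x = (\<Sum>i\<in>I. A i *v x)"
  for A :: "'i \<Rightarrow> real ^ 'n ^ 'm"
  by (induction I rule: infinite_finite_induct) (auto simp: matrix_vector_mult_add_rdistrib)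

lemma matrix_vector_mult_sum_right: "A *v (\<Sum>i\<in>I. x i) = (\<Sum>i\<in>I. A *v x i)"
  for A :: "real ^ 'n ^ 'm"
  by (induction I rule: infinite_finite_induct) (auto simp: matrix_vector_right_distrib)

lemma sum_outer_mult_vec:
  "(\<Sum>i\<in>I. s i *\<^sub>R outer (u i) (v i)) *v x = (\<Sum>i\<in>I. (s i * (v i \<bullet> x)) *\<^sub>R u i)"
  by (simp add: matrix_vector_mult_sum scaleR_matrix_vector_assoc[symmetric] outer_mult_vec)

section \<open>Finite orthonormal families\<close>

definition orthonormal_upto :: "nat \<Rightarrow> (nat \<Rightarrow> 'a::real_inner) \<Rightarrow> bool"
  where "orthonormal_upto r v \<longleftrightarrow> (\<forall>i<r. \<forall>j<r. v i \<bullet> v j = (if i = j then 1 else 0))"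

lemma orthonormal_uptoD:
  "orthonormal_upto r v \<Longrightarrow> i < r \<Longrightarrow> j < r \<Longrightarrow> v i \<bullet> v j = (if i = j then 1 else 0)"
  by (auto simp: orthonormal_upto_def)

lemma orthonormal_upto_norm: "orthonormal_upto r v \<Longrightarrow> i < r \<Longrightarrow> norm (v i) = 1"
  by (simp add: norm_eq_sqrt_inner orthonormal_uptoD)

lemma orthonormal_upto_inner_sum:
  assumes "orthonormal_upto r v" "i < r"
  shows "v i \<bullet> (\<Sum>j<r. c j *\<^sub>R v j) = c i"
proof -
  have "v i \<bullet> (\<Sum>j<r. c j *\<^sub>R v j) = (\<Sum>j<r. if i = j then c j else 0)"
    unfolding inner_sum_right
    by (rule sum.cong) (use assms in \<open>auto simp: orthonormal_uptoD\<close>)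
  then show ?thesis
    using assms(2) by simp
qed

lemma orthonormal_upto_norm_sum:
  assumes "orthonormal_upto r v"
  shows "(norm (\<Sum>j<r. c j *\<^sub>R v j))\<^sup>2 = (\<Sum>j<r. (c j)\<^sup>2)"
proof -
  have "(norm (\<Sum>j<r. c j *\<^sub>R v j))\<^sup>2 = (\<Sum>i<r. c i * (v i \<bullet> (\<Sum>j<r. c j *\<^sub>R v j)))"
    by (simp add: power2_norm_eq_inner inner_sum_left)
  also have "\<dots> = (\<Sum>i<r. (c i)\<^sup>2)"
    by (rule sum.cong) (auto simp: orthonormal_upto_inner_sum[OF assms] power2_eq_square)
  finally show ?thesis .
qed

lemma Bessel_upto:
  assumes "orthonormal_upto r v"
  shows "(\<Sum>j<r. (v j \<bullet> x)\<^sup>2) \<le> (norm x)\<^sup>2"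
proof -
  let ?p = "\<Sum>j<r. (v j \<bullet> x) *\<^sub>R v j"
  have "0 \<le> (norm (x - ?p))\<^sup>2"
    by simp
  also have "\<dots> = (norm x)\<^sup>2 + (norm ?p)\<^sup>2 - 2 * (x \<bullet> ?p)"
    by (simp add: power2_norm_eq_inner inner_diff_left inner_diff_right inner_commute)
  also have "x \<bullet> ?p = (\<Sum>j<r. (v j \<bullet> x)\<^sup>2)"
    by (simp add: inner_sum_right power2_eq_square inner_commute)
  finally show ?thesis
    by (simp add: orthonormal_upto_norm_sum[OF assms])
qed

text \<open>Double counting: the squared norms add up to \<open>r\<close>, and after exchanging the
  sums Bessel's inequality bounds the share of each basis vector by 1.\<close>

lemma orthonormal_upto_le_DIM:
  fixes v :: "nat \<Rightarrow> 'a::euclidean_space"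
  assumes "orthonormal_upto r v"
  shows "r \<le> DIM('a)"
proof -
  have "real r = (\<Sum>j<r. (norm (v j))\<^sup>2)"
    by (simp add: orthonormal_upto_norm[OF assms])
  also have "\<dots> = (\<Sum>j<r. \<Sum>b\<in>Basis. (v j \<bullet> b)\<^sup>2)"
    unfolding power2_norm_eq_inner
    by (subst euclidean_inner) (simp add: power2_eq_square)
  also have "\<dots> = (\<Sum>b\<in>Basis. \<Sum>j<r. (v j \<bullet> b)\<^sup>2)"
    by (rule sum.swap)
  also have "\<dots> \<le> (\<Sum>b\<in>(Basis :: 'a set). (norm b)\<^sup>2)"
    by (intro sum_mono Bessel_upto assms)
  finally show ?thesis
    by simp
qed

lemma compact_svd_alt:
  "compact_svd A r u s v \<longleftrightarrow> orthonormal_upto r u \<and> orthonormal_upto r v \<and> (\<forall>i<r. 0 < s i) \<and>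
    A = (\<Sum>i<r. s i *\<^sub>R outer (u i) (v i))"
  by (simp add: compact_svd_def orthonormal_upto_def)

section \<open>Existence of the compact singular value decomposition\<close>

lemma linear_le_quadratic_imp_zero:
  fixes b c :: real
  assumes "\<And>t. t * b \<le> t\<^sup>2 * c"
  shows "b = 0"
proof (rule ccontr)
  assume "b \<noteq> 0"
  \<comment> \<open>Any positive \<open>C\<close> exceeding \<open>c\<close> makes
    \<open>t = b / C\<close> violate the inequality unless \<open>b = 0\<close>.\<close>
  define C where "C = \<bar>c\<bar> + 1"
  have C: "C > 0" "c < C" by (auto simp: C_def)
  from assms[of "b / C"] have "b\<^sup>2 / C \<le> (b\<^sup>2 / C) * (c / C)"
    by (simp add: power2_eq_square)
  moreover have "b\<^sup>2 / C > 0"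
    using \<open>b \<noteq> 0\<close> C by simp
  moreover have "c / C < 1"
    using C by simp
  ultimately show False
    by (smt (verit, best) mult_less_cancel_left2)
qed

text \<open>Moving from \<open>z\<close> to \<open>z + t w\<close> with \<open>w\<close> orthogonal
  to \<open>z\<close> changes the squared norm of the argument only to second order in
  \<open>t\<close>, but that of its image by \<open>2 t (A z \<bullet> A w)\<close> to first order.
  At a maximiser of the quotient the first-order term must vanish.\<close>

lemma maximizer_orthogonal_image:
  fixes A :: "real ^ 'n ^ 'm"
  assumes S: "subspace S" and z: "z \<in> S" "norm z = 1"
    and max: "\<And>y. y \<in> S \<Longrightarrow> norm y = 1 \<Longrightarrow> norm (A *v y) \<le> norm (A *v z)"
    and w: "w \<in> S" "z \<bullet> w = 0"
  shows "(A *v z) \<bullet> (A *v w) = 0"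
proof -
  have hom: "(norm (A *v y))\<^sup>2 \<le> (norm (A *v z))\<^sup>2 * (norm y)\<^sup>2" if "y \<in> S" for y
  proof (cases "y = 0")
    case False
    have "norm (A *v (inverse (norm y) *\<^sub>R y)) \<le> norm (A *v z)"
      using False that by (intro max) (auto intro: subspace_scale[OF S])
    then have "norm (A *v y) \<le> norm (A *v z) * norm y"
      using False by (simp add: matrix_vector_mult_scaleR field_simps)
    then show ?thesis
      by (metis norm_ge_zero power_mono power_mult_distrib)
  qed simp
  have "t * (2 * ((A *v z) \<bullet> (A *v w))) \<le> t\<^sup>2 * ((norm (A *v z))\<^sup>2 * (norm w)\<^sup>2)" for t
  proof -
    have "z + t *\<^sub>R w \<in> S"
      using S z w by (simp add: subspace_add subspace_scale)
    from hom[OF this]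
    have "(norm (A *v z + t *\<^sub>R (A *v w)))\<^sup>2 \<le> (norm (A *v z))\<^sup>2 * (norm (z + t *\<^sub>R w))\<^sup>2"
      by (simp add: matrix_vector_right_distrib matrix_vector_mult_scaleR)
    moreover have "(norm (z + t *\<^sub>R w))\<^sup>2 = 1 + t\<^sup>2 * (norm w)\<^sup>2"
      using norm_add_Pythagorean[of z "t *\<^sub>R w"] z w
      by (simp add: orthogonal_def power_mult_distrib)
    moreover have "(norm (A *v z + t *\<^sub>R (A *v w)))\<^sup>2 =
        (norm (A *v z))\<^sup>2 + 2 * t * ((A *v z) \<bullet> (A *v w)) + t\<^sup>2 * (norm (A *v w))\<^sup>2"
      using dot_norm[of "A *v z" "t *\<^sub>R (A *v w)"] by (simp add: power_mult_distrib)
    ultimately have "(norm (A *v z))\<^sup>2 + 2 * t * ((A *v z) \<bullet> (A *v w)) + t\<^sup>2 * (norm (A *v w))\<^sup>2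
        \<le> (norm (A *v z))\<^sup>2 + t\<^sup>2 * ((norm (A *v z))\<^sup>2 * (norm w)\<^sup>2)"
      by (simp add: algebra_simps)
    moreover have "0 \<le> t\<^sup>2 * (norm (A *v w))\<^sup>2"
      by simp
    ultimately show ?thesis
      by linarith
  qed
  then show ?thesis
    using linear_le_quadratic_imp_zero by fastforce
qed

text \<open>Right singular vectors are chosen greedily as maximisers of
  \<open>norm (A *v y)\<close>, which replaces an appeal to the spectral theorem. A family of
  maximal length exists because the empty one qualifies and the dimension bounds the length.\<close>

lemma compact_svd_exists:
  fixes A :: "real ^ 'n ^ 'm"
  shows "\<exists>r u s v. compact_svd A r u s v"
proof -
  define Sp where "Sp k v = {w. \<forall>j<k. v j \<bullet> w = 0}" for k and v :: "nat \<Rightarrow> real ^ 'n"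
  \<comment> \<open>The last clause is the invariant: the images of the chosen vectors are
    orthogonal to the image of the whole complement \<open>Sp k v\<close>, so every later choice has
    an orthogonal image.\<close>
  define P where "P k \<longleftrightarrow> (\<exists>v. orthonormal_upto k v \<and> (\<forall>i<k. A *v v i \<noteq> 0) \<and>
      (\<forall>i<k. \<forall>j<k. i \<noteq> j \<longrightarrow> (A *v v i) \<bullet> (A *v v j) = 0) \<and>
      (\<forall>i<k. \<forall>w\<in>Sp k v. (A *v v i) \<bullet> (A *v w) = 0))" for k
  have "P 0"
    by (auto simp: P_def orthonormal_upto_def)
  moreover have "k \<le> DIM(real ^ 'n)" if "P k" for k
    using that orthonormal_upto_le_DIM unfolding P_def by blast
  ultimately obtain k where k: "P k" and k_max: "\<And>j. P j \<Longrightarrow> j \<le> k"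
    using Greatest_le_nat[of P] GreatestI_nat[of P] by metis
  from k obtain v where v: "orthonormal_upto k v" "\<And>i. i < k \<Longrightarrow> A *v v i \<noteq> 0"
    "\<And>i j. i < k \<Longrightarrow> j < k \<Longrightarrow> i \<noteq> j \<Longrightarrow> (A *v v i) \<bullet> (A *v v j) = 0"
    "\<And>i w. i < k \<Longrightarrow> w \<in> Sp k v \<Longrightarrow> (A *v v i) \<bullet> (A *v w) = 0"
    unfolding P_def by blast
  have sub: "subspace (Sp k v)"
    by (auto simp: Sp_def subspace_def inner_add_right)
  \<comment> \<open>If \<open>A\<close> did not vanish on the complement, a maximiser on its unit
    sphere would extend the family to length \<open>k + 1\<close>, against maximality of
    \<open>k\<close>.\<close>
  have null: "A *v w = 0" if w: "w \<in> Sp k v" for w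
  proof (rule ccontr)
    assume Aw: "A *v w \<noteq> 0"
    then have "w \<noteq> 0" by auto
    let ?U = "{y \<in> Sp k v. norm y = 1}"
    have "closed (Sp k v)"
      using sub by (rule closed_subspace)
    then have "compact (Sp k v \<inter> sphere 0 1)"
      by (intro closed_Int_compact) auto
    also have "Sp k v \<inter> sphere 0 1 = ?U" by auto
    finally have "compact ?U" .
    moreover have w': "inverse (norm w) *\<^sub>R w \<in> ?U"
      using w \<open>w \<noteq> 0\<close> by (auto intro: subspace_scale[OF sub])
    moreover have "continuous_on ?U (\<lambda>y. norm (A *v y))"
      by (intro continuous_intros)
    ultimately obtain z where z: "z \<in> Sp k v" "norm z = 1"
      and max: "\<And>y. y \<in> Sp k v \<Longrightarrow> norm y = 1 \<Longrightarrow> norm (A *v y) \<le> norm (A *v z)"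
      using continuous_attains_sup[of ?U "\<lambda>y. norm (A *v y)"] by blast
    have "norm (A *v z) > 0"
      using w' Aw \<open>w \<noteq> 0\<close>
      by (intro less_le_trans[OF _ max[of "inverse (norm w) *\<^sub>R w"]])
         (auto simp: matrix_vector_mult_scaleR)
    then have Az: "A *v z \<noteq> 0" by auto
    define v' where "v' = v(k := z)"
    have v': "v' i = v i" if "i < k" for i using that by (simp add: v'_def)
    have v'k: "v' k = z" by (simp add: v'_def)
    have vz: "v i \<bullet> z = 0" if "i < k" for i using z that by (auto simp: Sp_def)
    have Sp': "Sp (Suc k) v' = {w \<in> Sp k v. z \<bullet> w = 0}"
      by (auto simp: Sp_def less_Suc_eq v' v'k)
    have "P (Suc k)"
      unfolding P_def
    proof (intro exI[of _ v'] conjI)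
      show "orthonormal_upto (Suc k) v'"
        using v(1) z(2) vz
        by (auto simp: orthonormal_upto_def less_Suc_eq v' v'k norm_eq_1 inner_commute)
      show "\<forall>i<Suc k. A *v v' i \<noteq> 0"
        using v(2) Az by (auto simp: less_Suc_eq v' v'k)
      show "\<forall>i<Suc k. \<forall>j<Suc k. i \<noteq> j \<longrightarrow> (A *v v' i) \<bullet> (A *v v' j) = 0"
        using v(3) v(4)[OF _ z(1)] by (auto simp: less_Suc_eq v' v'k inner_commute)
      show "\<forall>i<Suc k. \<forall>w\<in>Sp (Suc k) v'. (A *v v' i) \<bullet> (A *v w) = 0"
        using v(4) maximizer_orthogonal_image[OF sub z max]
        by (auto simp: less_Suc_eq v' v'k Sp')
    qed
    from k_max[OF this] show False by simp
  qed
  define s where "s i = norm (A *v v i)" for i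
  define u where "u i = inverse (s i) *\<^sub>R (A *v v i)" for i
  have s: "s i > 0" if "i < k" for i
    using v(2)[OF that] by (simp add: s_def)
  have su: "s i *\<^sub>R u i = A *v v i" if "i < k" for i
    using s[OF that] by (simp add: u_def)
  have "u i \<bullet> u j = (if i = j then 1 else 0)" if "i < k" "j < k" for i j
  proof (cases "i = j")
    case True
    then show ?thesis
      using s[OF that(2)]
      by (simp add: u_def s_def dot_square_norm power2_eq_square)
  next
    case False
    then show ?thesis
      using v(3)[OF that] by (simp add: u_def)
  qed
  then have "orthonormal_upto k u"
    by (simp add: orthonormal_upto_def)
  moreover have "A = (\<Sum>i<k. s i *\<^sub>R outer (u i) (v i))"
  proof -
    have "A *v x = (\<Sum>i<k. s i *\<^sub>R outer (u i) (v i)) *v x" for x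
    proof -
      let ?p = "\<Sum>i<k. (v i \<bullet> x) *\<^sub>R v i"
      \<comment> \<open>The residual of the projection lies in the complement, where
        \<open>A\<close> vanishes, so \<open>A\<close> is determined by its values on the
        \<open>v i\<close>.\<close>
      have "x - ?p \<in> Sp k v"
        by (simp add: Sp_def inner_diff_right orthonormal_upto_inner_sum[OF v(1)])
      from null[OF this] have "A *v x = A *v ?p"
        by (simp add: matrix_vector_mult_diff_distrib)
      also have "\<dots> = (\<Sum>i<k. (v i \<bullet> x) *\<^sub>R (A *v v i))"
        by (simp add: matrix_vector_mult_sum_right matrix_vector_mult_scaleR)
      also have "\<dots> = (\<Sum>i<k. (s i * (v i \<bullet> x)) *\<^sub>R u i)"
        by (rule sum.cong) (simp_all add: su[symmetric])
      finally show ?thesis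
        by (simp add: sum_outer_mult_vec)
    qed
    then show ?thesis
      by (simp add: matrix_eq)
  qed
  ultimately have "compact_svd A k u s v"
    using v(1) s by (simp add: compact_svd_alt)
  then show ?thesis
    by blast
qed

section \<open>Orthogonalisation by Newton--Schulz iteration\<close>

text \<open>
  The Newton--Schulz map acts on singular values as \<open>s \<mapsto> (3 s - s\<^sup>3) / 2\<close>, whose iterates
  from any point of \<open>(0, 1]\<close> increase to 1. This exhibits \<^const>\<open>Orth\<close> as a pointwise limit of
  Borel functions and shows that the value does not depend on the decomposition.
\<close>

definition newton_schulz :: "real ^ 'n ^ 'm \<Rightarrow> real ^ 'n ^ 'm"
  where "newton_schulz A = (3 / 2) *\<^sub>R A - (1 / 2) *\<^sub>R (A ** transpose A ** A)"

definition newton_schulz_sv :: "real \<Rightarrow> real"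
  where "newton_schulz_sv s = (3 * s - s ^ 3) / 2"

lemma newton_schulz_sum_outer:
  fixes u :: "nat \<Rightarrow> real ^ 'm" and v :: "nat \<Rightarrow> real ^ 'n"
  assumes u: "orthonormal_upto r u" and v: "orthonormal_upto r v"
  shows "newton_schulz (\<Sum>i<r. s i *\<^sub>R outer (u i) (v i)) =
    (\<Sum>i<r. newton_schulz_sv (s i) *\<^sub>R outer (u i) (v i))" (is "newton_schulz ?A = ?B")
proof -
  have tr: "transpose ?A = (\<Sum>i<r. s i *\<^sub>R outer (v i) (u i))"
  proof -
    have "linear (transpose :: real ^ 'n ^ 'm \<Rightarrow> real ^ 'm ^ 'n)"
      by (rule linearI) (simp_all add: transpose_def vec_eq_iff)
    then show ?thesis
      by (simp add: linear_sum linear_scale transpose_outer)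
  qed
  have "newton_schulz ?A *v x = ?B *v x" for x
  proof -
    have 1: "?A *v x = (\<Sum>i<r. (s i * (v i \<bullet> x)) *\<^sub>R u i)"
      by (rule sum_outer_mult_vec)
    have 2: "transpose ?A *v (?A *v x) = (\<Sum>i<r. (s i * (s i * (v i \<bullet> x))) *\<^sub>R v i)"
      unfolding 1 tr sum_outer_mult_vec
      by (rule sum.cong) (simp_all add: orthonormal_upto_inner_sum[OF u])
    have 3: "?A *v (transpose ?A *v (?A *v x)) =
        (\<Sum>i<r. (s i * (s i * (s i * (v i \<bullet> x)))) *\<^sub>R u i)"
      unfolding 2 unfolding sum_outer_mult_vec
      by (rule sum.cong) (simp_all add: orthonormal_upto_inner_sum[OF v])
    have "newton_schulz ?A *v x =
        (3 / 2) *\<^sub>R (?A *v x) - (1 / 2) *\<^sub>R (?A *v (transpose ?A *v (?A *v x)))"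
      by (simp only: newton_schulz_def matrix_vector_mult_diff_rdistrib
          scaleR_matrix_vector_assoc[symmetric] matrix_vector_mul_assoc[symmetric])
    also have "\<dots> = ?B *v x"
      unfolding 3 unfolding 1 sum_outer_mult_vec
      by (simp add: scaleR_sum_right sum_subtractf[symmetric] scaleR_diff_left[symmetric]
          newton_schulz_sv_def power3_eq_cube field_simps)
    finally show ?thesis .
  qed
  then show ?thesis
    by (simp add: matrix_eq)
qed

lemma newton_schulz_funpow_sum_outer:
  assumes "orthonormal_upto r u" "orthonormal_upto r v"
  shows "(newton_schulz ^^ k) (\<Sum>i<r. s i *\<^sub>R outer (u i) (v i)) =
    (\<Sum>i<r. (newton_schulz_sv ^^ k) (s i) *\<^sub>R outer (u i) (v i))"
  by (induction k) (simp_all add: newton_schulz_sum_outer[OF assms])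

text \<open>The increment factors as \<open>s (1 - s) (1 + s) / 2\<close> and the remaining gap as
  \<open>(1 - s)^2 (2 + s) / 2\<close>. The last bound weakens quadratic convergence to a linear
  factor, which is all that the limit requires.\<close>

lemma newton_schulz_sv_bounds:
  assumes "0 < s" "s \<le> 1"
  shows "s \<le> newton_schulz_sv s" "newton_schulz_sv s \<le> 1"
    "1 - newton_schulz_sv s \<le> (1 - s) * (1 - s / 2)"
proof -
  have "newton_schulz_sv s - s = s * (1 - s) * (1 + s) / 2"
    by (simp add: newton_schulz_sv_def power3_eq_cube field_simps)
  also have "\<dots> \<ge> 0"
    using assms by simp
  finally show "s \<le> newton_schulz_sv s" by simp
  have "1 - newton_schulz_sv s = (1 - s) * ((1 - s) * (2 + s) / 2)"
    by (simp add: newton_schulz_sv_def power3_eq_cube field_simps)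
  moreover have "(1 - s) * (2 + s) / 2 \<le> 1 - s / 2"
    using assms by (simp add: field_simps)
  then have "(1 - s) * ((1 - s) * (2 + s) / 2) \<le> (1 - s) * (1 - s / 2)"
    using assms by (intro mult_left_mono) auto
  moreover have "0 \<le> (1 - s) * ((1 - s) * (2 + s) / 2)"
    using assms by simp
  ultimately show "newton_schulz_sv s \<le> 1" "1 - newton_schulz_sv s \<le> (1 - s) * (1 - s / 2)"
    by linarith+
qed

text \<open>The iterates never fall below the starting point \<open>s\<close>, so every step shrinks
  the gap to 1 by at least the fixed factor \<open>1 - s / 2\<close>.\<close>

lemma newton_schulz_sv_LIMSEQ:
  assumes s: "0 < s" "s \<le> 1"
  shows "(\<lambda>k. (newton_schulz_sv ^^ k) s) \<longlonglongrightarrow> 1"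
proof -
  let ?h = "\<lambda>k. (newton_schulz_sv ^^ k) s"
  have *: "s \<le> ?h k \<and> ?h k \<le> 1 \<and> 1 - ?h k \<le> (1 - s / 2) ^ k" for k
  proof (induction k)
    case 0
    then show ?case using s by simp
  next
    case (Suc k)
    note b = newton_schulz_sv_bounds[of "?h k"]
    have "1 - ?h (Suc k) \<le> (1 - ?h k) * (1 - ?h k / 2)"
      using b(3) Suc s by simp
    also have "\<dots> \<le> (1 - s / 2) ^ k * (1 - s / 2)"
      using Suc s by (intro mult_mono) auto
    finally show ?case
      using b(1,2) Suc s by (simp add: mult.commute)
  qed
  have "(\<lambda>k. (1 - s / 2) ^ k) \<longlonglongrightarrow> 0"
    using s by (intro LIMSEQ_realpow_zero) auto
  then have "(\<lambda>k. 1 - (1 - s / 2) ^ k) \<longlonglongrightarrow> 1 - 0"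
    by (intro tendsto_diff tendsto_const)
  then show ?thesis
    using * by (intro tendsto_sandwich[of "\<lambda>k. 1 - (1 - s / 2) ^ k" ?h sequentially "\<lambda>_. 1"])
      (auto intro!: always_eventually simp: algebra_simps)
qed

lemma compact_svd_mult_vec_right:
  assumes "compact_svd A r u s v" "i < r"
  shows "A *v v i = s i *\<^sub>R u i"
proof -
  have "A *v v i = (\<Sum>j<r. if j = i then s i *\<^sub>R u i else 0)"
  proof -
    have v: "orthonormal_upto r v" and A: "A = (\<Sum>i<r. s i *\<^sub>R outer (u i) (v i))"
      using assms(1) by (auto simp: compact_svd_alt)
    show ?thesis
      unfolding A sum_outer_mult_vec
      by (rule sum.cong) (use assms(2) in \<open>auto simp: orthonormal_uptoD[OF v]\<close>)
  qed
  then show ?thesis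
    using assms(2) by simp
qed

text \<open>Division by the Frobenius norm moves all singular values into the interval (0, 1], since
  each is the inner product of \<open>A\<close> with a unit matrix. The sequence is built from
  \<open>A\<close> alone, whichever decomposition is given.\<close>

lemma newton_schulz_LIMSEQ:
  assumes svd: "compact_svd A r u s v"
  shows "(\<lambda>k. (newton_schulz ^^ k) (inverse (norm A) *\<^sub>R A)) \<longlonglongrightarrow> (\<Sum>i<r. outer (u i) (v i))"
proof -
  have u: "orthonormal_upto r u" and v: "orthonormal_upto r v" and s: "\<And>i. i < r \<Longrightarrow> 0 < s i"
    and A: "A = (\<Sum>i<r. s i *\<^sub>R outer (u i) (v i))"
    using svd by (auto simp: compact_svd_alt)
  have s_le: "s i \<le> norm A" if "i < r" for i
  proof -
    have "s i = A \<bullet> outer (u i) (v i)"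
      using that by (simp add: inner_outer compact_svd_mult_vec_right[OF svd] orthonormal_uptoD[OF u])
    also have "\<dots> \<le> norm A * norm (outer (u i) (v i))"
      by (rule norm_cauchy_schwarz)
    finally show ?thesis
      using that by (simp add: norm_outer orthonormal_upto_norm[OF u] orthonormal_upto_norm[OF v])
  qed
  let ?s = "\<lambda>i. inverse (norm A) * s i"
  have "(newton_schulz ^^ k) (inverse (norm A) *\<^sub>R A) =
      (\<Sum>i<r. (newton_schulz_sv ^^ k) (?s i) *\<^sub>R outer (u i) (v i))" for k
  proof -
    have "inverse (norm A) *\<^sub>R A = (\<Sum>i<r. ?s i *\<^sub>R outer (u i) (v i))"
      by (subst (2) A) (simp add: scaleR_sum_right)
    then show ?thesis
      by (simp only: newton_schulz_funpow_sum_outer[OF u v])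
  qed
  moreover have "(\<lambda>k. \<Sum>i<r. (newton_schulz_sv ^^ k) (?s i) *\<^sub>R outer (u i) (v i))
      \<longlonglongrightarrow> (\<Sum>i<r. 1 *\<^sub>R outer (u i) (v i))"
  proof (intro tendsto_sum tendsto_scaleR newton_schulz_sv_LIMSEQ tendsto_const)
    fix i assume "i \<in> {..<r}"
    then have si: "0 < s i" "s i \<le> norm A"
      using s s_le by auto
    then have "norm A > 0"
      by linarith
    with si show "0 < ?s i" "?s i \<le> 1"
      by (auto simp: field_simps)
  qed
  ultimately show ?thesis
    by simp
qed

text \<open>Any two decompositions describe the limit of one and the same sequence, which is the
  uniqueness that \<open>THE\<close> asks for. For \<open>A = 0\<close> positivity of the singular
  values forces \<open>r = 0\<close>, and the sum is empty.\<close>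

lemma Orth_eq_sum_outer:
  assumes svd: "compact_svd A r u s v"
  shows "Orth A = (\<Sum>i<r. outer (u i) (v i))"
proof (cases "A = 0")
  case True
  have "s i *\<^sub>R u i = 0" if "i < r" for i
    using compact_svd_mult_vec_right[OF svd that] True by simp
  moreover have "s i *\<^sub>R u i \<noteq> 0" if "i < r" for i
    using svd that orthonormal_upto_norm[of r u i] by (force simp: compact_svd_alt)
  ultimately have "r = 0"
    by blast
  with True show ?thesis
    by (simp add: Orth_def)
next
  case False
  have "(THE Q. \<exists>r u s v. compact_svd A r u s v \<and> Q = (\<Sum>i<r. outer (u i) (v i))) =
      (\<Sum>i<r. outer (u i) (v i))"
  proof (rule the_equality)
    fix Q assume "\<exists>r u s v. compact_svd A r u s v \<and> Q = (\<Sum>i<r. outer (u i) (v i))"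
    then show "Q = (\<Sum>i<r. outer (u i) (v i))"
      using newton_schulz_LIMSEQ LIMSEQ_unique[OF _ newton_schulz_LIMSEQ[OF svd]] by blast
  qed (use svd in blast)
  with False show ?thesis
    by (simp add: Orth_def)
qed

section \<open>Norm bounds and measurability of \<open>Orth\<close>\<close>

lemma norm_Orth_le:
  fixes A :: "real ^ 'n ^ 'm"
  shows "norm (Orth A) \<le> sqrt (real CARD('n))"
proof -
  obtain r u s v where svd: "compact_svd A r u s v"
    using compact_svd_exists by blast
  then have u: "orthonormal_upto r u" and v: "orthonormal_upto r v"
    by (auto simp: compact_svd_alt)
  have O: "Orth A *v x = (\<Sum>i<r. (v i \<bullet> x) *\<^sub>R u i)" for x
    using sum_outer_mult_vec[of "\<lambda>_. 1"] by (simp add: Orth_eq_sum_outer[OF svd])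
  have "(norm (Orth A))\<^sup>2 = (\<Sum>i<r. u i \<bullet> (Orth A *v v i))"
    by (simp add: power2_norm_eq_inner) (simp add: Orth_eq_sum_outer[OF svd] inner_sum_right inner_outer)
  also have "\<dots> = (\<Sum>i<r. 1)"
    by (rule sum.cong) (simp_all add: O orthonormal_upto_inner_sum[OF u] orthonormal_uptoD[OF v])
  \<comment> \<open>The squared norm is the rank \<open>r\<close>, and the right singular vectors
    live in dimension \<open>CARD('n)\<close>; this is the origin of the factor n in the
    constants.\<close>
  also have "\<dots> \<le> real CARD('n)"
    using orthonormal_upto_le_DIM[OF v] by simp
  finally show ?thesis
    by (rule real_le_rsqrt)
qed

text \<open>\<open>Orth A\<close> is a partial isometry: it carries the coefficients of
  \<open>x\<close> along the \<open>v i\<close> over to the \<open>u i\<close>, and Bessel's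
  inequality bounds them.\<close>

lemma norm_Orth_mult_vec_le: "norm (Orth A *v x) \<le> norm x"
proof -
  obtain r u s v where svd: "compact_svd A r u s v"
    using compact_svd_exists by blast
  then have u: "orthonormal_upto r u" and v: "orthonormal_upto r v"
    by (auto simp: compact_svd_alt)
  have "Orth A *v x = (\<Sum>i<r. (v i \<bullet> x) *\<^sub>R u i)"
    using sum_outer_mult_vec[of "\<lambda>_. 1"] by (simp add: Orth_eq_sum_outer[OF svd])
  then have "(norm (Orth A *v x))\<^sup>2 \<le> (norm x)\<^sup>2"
    using Bessel_upto[OF v] by (simp add: orthonormal_upto_norm_sum[OF u])
  then show ?thesis
    by simp
qed

lemma continuous_on_matrix_mult:
  fixes f :: "'a::topological_space \<Rightarrow> real ^ 'k ^ 'm" and g :: "'a \<Rightarrow> real ^ 'n ^ 'k"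
  assumes "continuous_on S f" "continuous_on S g"
  shows "continuous_on S (\<lambda>x. f x ** g x)"
  unfolding matrix_matrix_mult_def by (intro continuous_intros assms)

lemma continuous_on_newton_schulz: "continuous_on S newton_schulz"
  unfolding newton_schulz_def transpose_def
  by (intro continuous_intros continuous_on_matrix_mult)

text \<open>The iterates are continuous maps applied to the normalised matrix. Normalisation is
  discontinuous at 0 but still Borel, and pointwise limits preserve that.\<close>

lemma borel_measurable_Orth [measurable]:
  "(Orth :: real ^ 'n ^ 'm \<Rightarrow> _) \<in> borel_measurable borel"
proof (rule borel_measurable_LIMSEQ_metric)
  have "newton_schulz \<in> borel_measurable (borel :: (real ^ 'n ^ 'm) measure)"
    by (intro borel_measurable_continuous_onI continuous_on_newton_schulz)
  then have "newton_schulz ^^ k \<in> borel_measurable (borel :: (real ^ 'n ^ 'm) measure)" for k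
    by (rule measurable_compose_n)
  moreover have "(\<lambda>A. inverse (norm A) *\<^sub>R A) \<in> borel_measurable (borel :: (real ^ 'n ^ 'm) measure)"
    by measurable
  ultimately show "(\<lambda>A. (newton_schulz ^^ k) (inverse (norm A) *\<^sub>R A))
      \<in> borel_measurable (borel :: (real ^ 'n ^ 'm) measure)" for k
    by (rule measurable_compose[rotated])
  show "(\<lambda>k. (newton_schulz ^^ k) (inverse (norm A) *\<^sub>R A)) \<longlonglongrightarrow> Orth A" for A :: "real ^ 'n ^ 'm"
  proof -
    obtain r u s v where "compact_svd A r u s v"
      using compact_svd_exists by blast
    then show ?thesis
      using newton_schulz_LIMSEQ Orth_eq_sum_outer by fastforce
  qed
qed

section \<open>Preconditioned alignment\<close>

lemma norm_cmul_vec_le: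
  fixes d u :: "real ^ 'k"
  assumes "\<And>i. \<bar>d $ i\<bar> \<le> b"
  shows "norm (d * u) \<le> b * norm u"
proof -
  have b: "0 \<le> b"
    using assms order_trans[OF abs_ge_zero] by blast
  have "(norm (d * u))\<^sup>2 = (\<Sum>i\<in>UNIV. \<bar>d $ i\<bar>\<^sup>2 * (u $ i)\<^sup>2)"
    unfolding power2_norm_eq_inner by (simp add: inner_vec_def power2_eq_square mult_ac)
  also have "\<dots> \<le> (\<Sum>i\<in>UNIV. b\<^sup>2 * (u $ i)\<^sup>2)"
    by (intro sum_mono mult_right_mono power_mono assms) auto
  also have "\<dots> = (b * norm u)\<^sup>2"
    unfolding power_mult_distrib power2_norm_eq_inner
    by (simp add: inner_vec_def power2_eq_square sum_distrib_left)
  finally show ?thesis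
    using b by (simp add: power2_le_iff_abs_le)
qed

text \<open>
  Both scalings are split into their midpoint multiple of the identity and a remainder; only the
  midpoints contribute to the lower bound.
\<close>

lemma Orth_alignment:
  fixes M B :: "real ^ 'n ^ 'm" and p :: "real ^ 'm" and q :: "real ^ 'n"
  assumes M: "\<And>i j. M $ i $ j = c * p $ i * B $ i $ j * q $ j"
    and p: "\<And>i. 1 \<le> p $ i" "\<And>i. p $ i \<le> \<rho>" and q: "\<And>j. 1 \<le> q $ j" "\<And>j. q $ j \<le> \<rho>'"
    and c: "0 \<le> c" and pos: "\<rho> * \<rho>' \<le> (\<rho> + 1) * (\<rho>' + 1) / 2"
  shows "((\<rho> + 1) * (\<rho>' + 1) / 2 - \<rho> * \<rho>') / (\<rho> * \<rho>') * norm M \<le> M \<bullet> Orth B"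
proof -
  obtain r u s v where svd: "compact_svd B r u s v"
    using compact_svd_exists by blast
  then have u: "orthonormal_upto r u" and v: "orthonormal_upto r v" and s: "\<And>i. i < r \<Longrightarrow> 0 < s i"
    and B: "B = (\<Sum>i<r. s i *\<^sub>R outer (u i) (v i))"
    by (auto simp: compact_svd_alt)
  have \<rho>: "1 \<le> \<rho>" "1 \<le> \<rho>'"
    using p q order_trans by blast+
  define \<kappa> where "\<kappa> = (\<rho> + 1) * (\<rho>' + 1) / 2 - \<rho> * \<rho>'"
  \<comment> \<open>With entrywise \<open>*\<close> on vectors, \<open>p * u i\<close> is the
    diagonal scaling of \<open>u i\<close>, so the two scalings move from the matrix onto the
    singular vectors.\<close>
  have M_sum: "M = c *\<^sub>R (\<Sum>i<r. s i *\<^sub>R outer (p * u i) (q * v i))"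
    by (simp add: vec_eq_iff M B outer_def sum_distrib_left sum_distrib_right mult_ac)
  have nu: "norm (u i) = 1" and nv: "norm (v i) = 1" if "i < r" for i
    using that orthonormal_upto_norm u v by blast+
  have Ov: "Orth B *v v i = u i" if "i < r" for i
  proof -
    have "Orth B *v v i = (\<Sum>j<r. (v j \<bullet> v i) *\<^sub>R u j)"
      using sum_outer_mult_vec[of "\<lambda>_. 1" u v] by (simp add: Orth_eq_sum_outer[OF svd])
    also have "\<dots> = (\<Sum>j<r. if j = i then u i else 0)"
      by (rule sum.cong) (use that in \<open>auto simp: orthonormal_uptoD[OF v]\<close>)
    finally have "Orth B *v v i = (\<Sum>j<r. if j = i then u i else 0)" .
    then show ?thesis
      using that by simp
  qed
  have align: "\<kappa> \<le> (p * u i) \<bullet> (Orth B *v (q * v i))" if i: "i < r" for i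
  proof -
    \<comment> \<open>The entries of \<open>p\<close> range over an interval from 1 to \<rho>;
      subtracting its midpoint leaves a remainder of at most half its length. The same is done for
      \<open>q\<close>.\<close>
    define p' where "p' = p - vec ((\<rho> + 1) / 2)"
    define q' where "q' = q - vec ((\<rho>' + 1) / 2)"
    have pu: "p * u i = ((\<rho> + 1) / 2) *\<^sub>R u i + p' * u i"
      by (simp add: p'_def vec_eq_iff algebra_simps)
    have qv: "q * v i = ((\<rho>' + 1) / 2) *\<^sub>R v i + q' * v i"
      by (simp add: q'_def vec_eq_iff algebra_simps)
    have "\<bar>p' $ j\<bar> \<le> (\<rho> - 1) / 2" for j
      using p(1)[of j] p(2)[of j] unfolding p'_def by (simp add: abs_le_iff field_simps)
    from norm_cmul_vec_le[OF this, of "u i"] have np: "norm (p' * u i) \<le> (\<rho> - 1) / 2"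
      using nu[OF i] by simp
    have "\<bar>q' $ j\<bar> \<le> (\<rho>' - 1) / 2" for j
      using q(1)[of j] q(2)[of j] unfolding q'_def by (simp add: abs_le_iff field_simps)
    from norm_cmul_vec_le[OF this, of "v i"] have nq: "norm (q' * v i) \<le> (\<rho>' - 1) / 2"
      using nv[OF i] by simp
    have "\<bar>q $ j\<bar> \<le> \<rho>'" for j
      using q(1)[of j] q(2)[of j] by simp
    from norm_cmul_vec_le[OF this, of "v i"] have nqv: "norm (q * v i) \<le> \<rho>'"
      using nv[OF i] by simp
    have "(p * u i) \<bullet> (Orth B *v (q * v i)) =
        ((\<rho> + 1) / 2) * (u i \<bullet> (Orth B *v (q * v i))) + (p' * u i) \<bullet> (Orth B *v (q * v i))"
      by (simp add: pu inner_add_left)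
    also have "u i \<bullet> (Orth B *v (q * v i)) = (\<rho>' + 1) / 2 + u i \<bullet> (Orth B *v (q' * v i))"
      using nu[OF i]
      by (simp add: qv matrix_vector_right_distrib matrix_vector_mult_scaleR inner_add_right Ov[OF i]
          norm_eq_1)
    finally have eq: "(p * u i) \<bullet> (Orth B *v (q * v i)) =
        ((\<rho> + 1) / 2) * ((\<rho>' + 1) / 2 + u i \<bullet> (Orth B *v (q' * v i)))
        + (p' * u i) \<bullet> (Orth B *v (q * v i))" .
    have "\<bar>u i \<bullet> (Orth B *v (q' * v i))\<bar> \<le> norm (u i) * norm (Orth B *v (q' * v i))"
      by (rule Cauchy_Schwarz_ineq2)
    also have "\<dots> \<le> (\<rho>' - 1) / 2"
      using order_trans[OF norm_Orth_mult_vec_le nq] nu[OF i] by simp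
    finally have "(\<rho>' + 1) / 2 - (\<rho>' - 1) / 2 \<le> (\<rho>' + 1) / 2 + u i \<bullet> (Orth B *v (q' * v i))"
      by linarith
    then have 1: "((\<rho> + 1) / 2) * ((\<rho>' + 1) / 2 - (\<rho>' - 1) / 2) \<le>
        ((\<rho> + 1) / 2) * ((\<rho>' + 1) / 2 + u i \<bullet> (Orth B *v (q' * v i)))"
      using \<rho> by (intro mult_left_mono) auto
    have "\<bar>(p' * u i) \<bullet> (Orth B *v (q * v i))\<bar> \<le> norm (p' * u i) * norm (Orth B *v (q * v i))"
      by (rule Cauchy_Schwarz_ineq2)
    also have "\<dots> \<le> ((\<rho> - 1) / 2) * \<rho>'"
      using np order_trans[OF norm_Orth_mult_vec_le nqv] \<rho> by (intro mult_mono) auto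
    finally have 2: "- (((\<rho> - 1) / 2) * \<rho>') \<le> (p' * u i) \<bullet> (Orth B *v (q * v i))"
      by linarith
    \<comment> \<open>The remainder of \<open>q\<close> is split off only in the term with the
      midpoint of \<open>p\<close>; next to the remainder of \<open>p\<close> the whole
      \<open>q * v i\<close> is bounded by \<open>\<rho>'\<close>. The two estimates then combine to
      exactly \<kappa>.\<close>
    have "\<kappa> = ((\<rho> + 1) / 2) * ((\<rho>' + 1) / 2 - (\<rho>' - 1) / 2) - ((\<rho> - 1) / 2) * \<rho>'"
      by (simp add: \<kappa>_def field_simps)
    with 1 2 eq show ?thesis
      by linarith
  qed
  \<comment> \<open>\<open>?S\<close> is \<open>c\<close> times the nuclear norm of
    \<open>B\<close>. It mediates between the two sides, bounding the inner product from below and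
    \<open>norm M\<close> from above.\<close>
  let ?S = "c * (\<Sum>i<r. s i)"
  have "M \<bullet> Orth B = Orth B \<bullet> M"
    by (rule inner_commute)
  also have "\<dots> = c * (\<Sum>i<r. s i * ((p * u i) \<bullet> (Orth B *v (q * v i))))"
    by (subst M_sum) (simp add: inner_sum_right inner_outer)
  also have "\<dots> \<ge> c * (\<Sum>i<r. s i * \<kappa>)"
    using align s c by (intro mult_left_mono sum_mono) (auto intro: less_imp_le)
  finally have lower: "\<kappa> * ?S \<le> M \<bullet> Orth B"
    unfolding sum_distrib_right[symmetric] by (simp only: mult_ac)
  have "norm M = c * norm (\<Sum>i<r. s i *\<^sub>R outer (p * u i) (q * v i))"
    using c by (subst M_sum) simp
  also have "\<dots> \<le> c * (\<Sum>i<r. s i * (\<rho> * \<rho>'))"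
  proof (intro mult_left_mono c order_trans[OF norm_sum] sum_mono)
    fix i assume "i \<in> {..<r}"
    then have i: "i < r" by simp
    have "norm (p * u i) \<le> \<rho> * norm (u i)" "norm (q * v i) \<le> \<rho>' * norm (v i)"
      using p q by (auto intro!: norm_cmul_vec_le simp: abs_le_iff) (smt (verit))+
    then have "norm (p * u i) * norm (q * v i) \<le> \<rho> * \<rho>'"
      using \<rho> nu[OF i] nv[OF i] by (intro mult_mono) auto
    then show "norm (s i *\<^sub>R outer (p * u i) (q * v i)) \<le> s i * (\<rho> * \<rho>')"
      using s[OF i] by (simp add: norm_outer)
  qed
  finally have upper: "norm M \<le> \<rho> * \<rho>' * ?S"
    unfolding sum_distrib_right[symmetric] by (simp only: mult_ac)
  \<comment> \<open>Here \<open>pos\<close> enters: \<kappa> must be nonnegative for the upper bound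
    on \<open>norm M\<close> to be multiplied by it.\<close>
  have "\<kappa> / (\<rho> * \<rho>') * norm M \<le> \<kappa> / (\<rho> * \<rho>') * (\<rho> * \<rho>' * ?S)"
    using upper pos \<rho> by (intro mult_left_mono) (auto simp: \<kappa>_def)
  also have "\<dots> = \<kappa> * ?S"
    using \<rho> by simp
  finally show ?thesis
    using lower by (simp add: \<kappa>_def)
qed

definition precondition :: "real \<Rightarrow> real ^ 'n ^ 'm \<Rightarrow> real ^ 'n ^ 'm"
  where "precondition \<epsilon> M = diag_inv_sqrt (D_row \<epsilon> M) ** M ** diag_inv_sqrt (D_col \<epsilon> M)"

lemma diag_mult_left: "(diag d ** A) $ i $ j = d $ i * A $ i $ j"
  by (simp add: diag_def matrix_matrix_mult_def if_distrib[of "\<lambda>x. x * _"] cong: if_cong)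

lemma diag_mult_right: "(A ** diag d) $ i $ j = A $ i $ j * d $ j"
  by (simp add: diag_def matrix_matrix_mult_def if_distrib[of "\<lambda>x. _ * x"] cong: if_cong)

lemma precondition_nth:
  "precondition \<epsilon> M $ i $ j =
    ((\<Sum>k\<in>UNIV. (M $ i $ k)\<^sup>2) + \<epsilon>) powr (- 1 / 2) * M $ i $ j *
    ((\<Sum>k\<in>UNIV. (M $ k $ j)\<^sup>2) + \<epsilon>) powr (- 1 / 2)"
  unfolding precondition_def diag_inv_sqrt_def diag_mult_left diag_mult_right
  by (simp add: D_row_def D_col_def diag_def rowsum_def colsum_def power2_eq_square)

lemma borel_measurable_precondition:
  assumes "\<epsilon> > 0"
  shows "(precondition \<epsilon> :: real ^ 'n ^ 'm \<Rightarrow> _) \<in> borel_measurable borel"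
proof (rule borel_measurable_continuous_onI)
  have ne: "(\<Sum>k\<in>I. (g k)\<^sup>2) + \<epsilon> \<noteq> 0" for I and g :: "'k \<Rightarrow> real"
    using add_nonneg_pos[OF sum_nonneg assms, of I "\<lambda>k. (g k)\<^sup>2"] by fastforce
  have "continuous_on UNIV (\<lambda>M :: real ^ 'n ^ 'm. \<chi> i j. precondition \<epsilon> M $ i $ j)"
    unfolding precondition_nth by (intro continuous_intros ballI ne)
  then show "continuous_on UNIV (precondition \<epsilon> :: real ^ 'n ^ 'm \<Rightarrow> _)"
    by (simp add: vec_lambda_eta)
qed

text \<open>Undoing the preconditioning writes \<open>M\<close> as \<epsilon> times a diagonal
  scaling of the preconditioned matrix. Taking the factor \<epsilon> out normalises the scalings to
  start at 1; a row has \<open>CARD('n)\<close> entries and a column \<open>CARD('m)\<close>, which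
  fixes their upper ends.\<close>

lemma precondition_alignment:
  fixes M :: "real ^ 'n ^ 'm"
  assumes \<epsilon>: "\<epsilon> > 0" and M: "\<And>i j. \<bar>M $ i $ j\<bar> \<le> g"
    and \<rho>: "\<rho> = sqrt (1 + real CARD('n) * g\<^sup>2 / \<epsilon>)"
    and \<rho>': "\<rho>' = sqrt (1 + real CARD('m) * g\<^sup>2 / \<epsilon>)"
    and pos: "\<rho> * \<rho>' \<le> (\<rho> + 1) * (\<rho>' + 1) / 2"
  shows "((\<rho> + 1) * (\<rho>' + 1) / 2 - \<rho> * \<rho>') / (\<rho> * \<rho>') * norm M
    \<le> M \<bullet> Orth (precondition \<epsilon> M)"
proof -
  have sq_le: "(M $ i $ j)\<^sup>2 \<le> g\<^sup>2" for i j
    using power_mono[OF M abs_ge_zero, of i j 2] by simp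
  have scale: "1 \<le> sqrt ((x + \<epsilon>) / \<epsilon>)" "sqrt ((x + \<epsilon>) / \<epsilon>) \<le> sqrt (1 + y / \<epsilon>)"
    if "0 \<le> x" "x \<le> y" for x y
    using that \<epsilon> by (simp_all add: field_simps)
  have cancel: "sqrt \<epsilon> * sqrt ((x + \<epsilon>) / \<epsilon>) * (x + \<epsilon>) powr (- 1 / 2) = 1" if "0 \<le> x" for x
  proof -
    have "sqrt \<epsilon> * sqrt ((x + \<epsilon>) / \<epsilon>) = (x + \<epsilon>) powr (1 / 2)"
      using that \<epsilon> by (simp add: real_sqrt_mult[symmetric] powr_half_sqrt)
    then have "sqrt \<epsilon> * sqrt ((x + \<epsilon>) / \<epsilon>) * (x + \<epsilon>) powr (- 1 / 2) =
        (x + \<epsilon>) powr (1 / 2 + - 1 / 2)"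
      by (simp only: powr_add)
    then show ?thesis
      using that \<epsilon> by simp
  qed
  define R where "R i = (\<Sum>k\<in>UNIV. (M $ i $ k)\<^sup>2)" for i
  define C where "C j = (\<Sum>k\<in>UNIV. (M $ k $ j)\<^sup>2)" for j
  have R: "0 \<le> R i" "R i \<le> real CARD('n) * g\<^sup>2" for i
    using sum_bounded_above[of UNIV "\<lambda>k. (M $ i $ k)\<^sup>2" "g\<^sup>2"] sq_le
    by (auto simp: R_def sum_nonneg)
  have C: "0 \<le> C j" "C j \<le> real CARD('m) * g\<^sup>2" for j
    using sum_bounded_above[of UNIV "\<lambda>k. (M $ k $ j)\<^sup>2" "g\<^sup>2"] sq_le
    by (auto simp: C_def sum_nonneg)
  show ?thesis
  proof (rule Orth_alignment[where c = \<epsilon> and p = "\<chi> i. sqrt ((R i + \<epsilon>) / \<epsilon>)"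
        and q = "\<chi> j. sqrt ((C j + \<epsilon>) / \<epsilon>)"])
    fix i j
    have "\<epsilon> * sqrt ((R i + \<epsilon>) / \<epsilon>) * precondition \<epsilon> M $ i $ j * sqrt ((C j + \<epsilon>) / \<epsilon>) =
        (sqrt \<epsilon> * sqrt \<epsilon>) * sqrt ((R i + \<epsilon>) / \<epsilon>) * precondition \<epsilon> M $ i $ j * sqrt ((C j + \<epsilon>) / \<epsilon>)"
      using \<epsilon> by simp
    also have "\<dots> = (sqrt \<epsilon> * sqrt ((R i + \<epsilon>) / \<epsilon>) * (R i + \<epsilon>) powr (- 1 / 2)) *
        (sqrt \<epsilon> * sqrt ((C j + \<epsilon>) / \<epsilon>) * (C j + \<epsilon>) powr (- 1 / 2)) * M $ i $ j"
      unfolding precondition_nth R_def[symmetric] C_def[symmetric] by (simp only: mult_ac)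
    also have "\<dots> = M $ i $ j"
      unfolding cancel[OF R(1)] cancel[OF C(1)] by simp
    finally show "M $ i $ j = \<epsilon> * (\<chi> i. sqrt ((R i + \<epsilon>) / \<epsilon>)) $ i * precondition \<epsilon> M $ i $ j *
        (\<chi> j. sqrt ((C j + \<epsilon>) / \<epsilon>)) $ j"
      by simp
  next
    show "1 \<le> (\<chi> i. sqrt ((R i + \<epsilon>) / \<epsilon>)) $ i" "(\<chi> i. sqrt ((R i + \<epsilon>) / \<epsilon>)) $ i \<le> \<rho>" for i
      using scale[OF R] by (simp_all add: \<rho>)
    show "1 \<le> (\<chi> j. sqrt ((C j + \<epsilon>) / \<epsilon>)) $ j" "(\<chi> j. sqrt ((C j + \<epsilon>) / \<epsilon>)) $ j \<le> \<rho>'" for j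
      using scale[OF C] by (simp_all add: \<rho>')
  qed (use \<epsilon> pos in auto)
qed

section \<open>Balls of the maximum norm\<close>

lemma infnorm_matrix_nth_le:
  fixes A :: "real ^ 'n ^ 'm"
  shows "\<bar>A $ i $ j\<bar> \<le> infnorm A"
proof -
  have "axis i (axis j 1) \<in> (Basis :: (real ^ 'n ^ 'm) set)"
    by (auto simp: Basis_vec_def)
  from Basis_le_infnorm[OF this, of A] show ?thesis
    by (simp add: inner_axis)
qed

lemma convex_infnorm_le: "convex {x :: 'a::euclidean_space. infnorm x \<le> c}"
proof (rule convexI)
  fix x y :: 'a and s t :: real
  assume *: "x \<in> {x. infnorm x \<le> c}" "y \<in> {x. infnorm x \<le> c}" "0 \<le> s" "0 \<le> t" "s + t = 1"
  have "infnorm (s *\<^sub>R x + t *\<^sub>R y) \<le> infnorm (s *\<^sub>R x) + infnorm (t *\<^sub>R y)"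
    by (rule infnorm_triangle)
  also have "\<dots> \<le> s * c + t * c"
    using * by (intro add_mono) (auto simp: infnorm_mul intro: mult_left_mono)
  also have "\<dots> = c"
    using * by (simp add: distrib_right[symmetric])
  finally show "s *\<^sub>R x + t *\<^sub>R y \<in> {x. infnorm x \<le> c}"
    by simp
qed

lemma bounded_infnorm_le: "bounded {x :: 'a::euclidean_space. infnorm x \<le> c}"
  unfolding bounded_iff
proof (intro exI ballI)
  fix x :: 'a assume "x \<in> {x. infnorm x \<le> c}"
  then show "norm x \<le> sqrt (real DIM('a)) * c"
    using norm_le_infnorm[of x] by (auto intro: order_trans mult_left_mono)
qed

section \<open>Sums of powers of the step index\<close>

lemma power_three_halves_sum_le:
  assumes "T \<ge> 1"
  shows "(\<Sum>t=1..T. real t powr (- 3 / 2)) \<le> 3 - 2 / sqrt (real T)"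
  using assms
proof (induction T rule: dec_induct)
  case base
  then show ?case by simp
next
  case (step T)
  \<comment> \<open>The subtracted \<open>2 / sqrt T\<close> makes the induction close: its decrease
    \<open>2 / x - 2 / y = 2 / (x y (x + y))\<close> dominates the new summand
    \<open>1 / y^3\<close>, because \<open>x \<le> y\<close>.\<close>
  define x y where "x = sqrt (real T)" and "y = sqrt (real (Suc T))"
  have xy: "0 < x" "0 < y" "y\<^sup>2 = x\<^sup>2 + 1" "x \<le> y"
    using step by (auto simp: x_def y_def)
  have "real (Suc T) powr (- 3 / 2) = real (Suc T) powr (- 1 / 2 - 1)"
    by simp
  also have "\<dots> = 1 / (y * y\<^sup>2)"
    by (subst powr_diff) (simp add: y_def powr_minus powr_half_sqrt field_simps)
  finally have p: "real (Suc T) powr (- 3 / 2) = 1 / (y * y\<^sup>2)" .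
  have "(y - x) * (y + x) = 1"
    using xy by (simp add: power2_eq_square algebra_simps)
  then have d: "y - x = 1 / (y + x)"
    using xy by (simp add: field_simps)
  have "1 / (y * y\<^sup>2) \<le> 2 / (x * y * (y + x))"
  proof -
    have "x * y * (y + x) \<le> 2 * (y * y\<^sup>2)"
    proof -
      have "x * y * (y + x) \<le> y * y * (y + y)"
        using xy by (intro mult_mono) auto
      then show ?thesis by (simp add: power2_eq_square algebra_simps)
    qed
    then have "2 / (2 * (y * y\<^sup>2)) \<le> 2 / (x * y * (y + x))"
      using xy(1,2) by (intro divide_left_mono) auto
    then show ?thesis
      by simp
  qed
  also have "\<dots> = 2 * (1 / (y + x)) / (x * y)"
    by simp
  also have "\<dots> = 2 / x - 2 / y"
    unfolding d[symmetric] using xy(1,2) by (simp add: field_simps)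
  finally show ?case
    using step p by (simp add: x_def[symmetric] y_def[symmetric] del: of_nat_Suc)
qed

lemma harm_le_ln: "T \<ge> 1 \<Longrightarrow> (\<Sum>t=1..T. 1 / real t) \<le> 1 + ln (real T)"
proof (induction T rule: dec_induct)
  case base
  then show ?case by simp
next
  case (step T)
  have "ln (real T / real (Suc T)) \<le> real T / real (Suc T) - 1"
    using step by (intro ln_le_minus_one) simp
  then have "1 / real (Suc T) \<le> ln (real (Suc T)) - ln (real T)"
    using step by (simp add: ln_div field_simps)
  with step show ?case
    by simp
qed

section \<open>Momentum with stochastic gradients\<close>

lemma norm_sq_linear_combination:
  "(norm (b *\<^sub>R u + c *\<^sub>R v))\<^sup>2 = b\<^sup>2 * (norm u)\<^sup>2 + c\<^sup>2 * (norm v)\<^sup>2 + 2 * b * c * (u \<bullet> v)"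
  using dot_norm[of "b *\<^sub>R u" "c *\<^sub>R v"] by (simp add: power_mult_distrib algebra_simps)

text \<open>The error analysis uses no matrix structure: \<open>g\<close> is the sample gradient,
  \<open>h\<close> its mean, \<open>dir\<close> any bounded Borel map. The bounded convex set
  \<open>S\<close> abstracts the almost sure bound on the samples; containing 0, it contains the
  initial momentum.\<close>

locale momentum_iterates = P: prob_space P + D: prob_space D
  for P :: "'w measure" and D :: "'s measure" +
  fixes g :: "'a::euclidean_space \<Rightarrow> 's \<Rightarrow> 'a" and h :: "'a \<Rightarrow> 'a"
    and \<xi> :: "nat \<Rightarrow> 'w \<Rightarrow> 's" and X M :: "nat \<Rightarrow> 'w \<Rightarrow> 'a" and dir :: "'a \<Rightarrow> 'a"
    and x\<^sub>1 :: 'a and \<gamma> \<beta> :: "nat \<Rightarrow> real" and L \<sigma> R :: real and S :: "'a set"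
  assumes g_measurable [measurable]: "(\<lambda>(y, z). g y z) \<in> borel_measurable (borel \<Otimes>\<^sub>M D)"
    and L_nonneg: "0 \<le> L"
    and h_lipschitz: "\<And>y z. norm (h z - h y) \<le> L * norm (z - y)"
    and g_integrable: "\<And>y. integrable D (g y)"
    and unbiased: "\<And>y. (\<integral>z. g y z \<partial>D) = h y"
    and variance: "\<And>y. (\<integral>z. (norm (g y z - h y))\<^sup>2 \<partial>D) \<le> \<sigma>\<^sup>2"
    and \<xi>_indep: "P.indep_vars (\<lambda>_. D) \<xi> {1..}"
    and \<xi>_distr: "\<And>t. t \<ge> 1 \<Longrightarrow> distr P D (\<xi> t) = D"
    and \<beta>: "\<And>t. t \<ge> 1 \<Longrightarrow> 0 \<le> \<beta> t" "\<And>t. t \<ge> 1 \<Longrightarrow> \<beta> t \<le> 1"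
    and M_0: "\<And>\<omega>. \<omega> \<in> space P \<Longrightarrow> M 0 \<omega> = 0"
    and X_1: "\<And>\<omega>. \<omega> \<in> space P \<Longrightarrow> X 1 \<omega> = x\<^sub>1"
    and M_step: "\<And>t \<omega>. t \<ge> 1 \<Longrightarrow> \<omega> \<in> space P \<Longrightarrow>
      M t \<omega> = \<beta> t *\<^sub>R M (t - 1) \<omega> + (1 - \<beta> t) *\<^sub>R g (X t \<omega>) (\<xi> t \<omega>)"
    and X_step: "\<And>t \<omega>. t \<ge> 1 \<Longrightarrow> \<omega> \<in> space P \<Longrightarrow> X (t + 1) \<omega> = X t \<omega> - \<gamma> t *\<^sub>R dir (M t \<omega>)"
    and dir_measurable [measurable]: "dir \<in> borel_measurable borel"
    and dir_bound: "\<And>y. norm (dir y) \<le> R"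
    and S: "convex S" "bounded S" "0 \<in> S"
    and g_in_S: "\<And>t. t \<ge> 1 \<Longrightarrow> AE \<omega> in P. g (X t \<omega>) (\<xi> t \<omega>) \<in> S"
begin

text \<open>The restriction makes the history a point of a finite product space, so that
  independence of disjoint blocks of samples applies. The sample at time \<open>t\<close> itself is
  excluded.\<close>

definition past :: "nat \<Rightarrow> 'w \<Rightarrow> nat \<Rightarrow> 's"
  where "past t \<omega> = (\<lambda>i\<in>{1..<t}. \<xi> i \<omega>)"

lemma \<xi>_measurable [measurable]: "t \<ge> 1 \<Longrightarrow> \<xi> t \<in> measurable P D"
  using \<xi>_indep by (auto simp: P.indep_vars_def)

lemma past_measurable [measurable]: "past t \<in> measurable P (Pi\<^sub>M {1..<t} (\<lambda>_. D))"
  unfolding past_def by (rule measurable_restrict) (use \<xi>_measurable in auto)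

lemma h_measurable [measurable]: "h \<in> borel_measurable borel"
proof -
  have "L-lipschitz_on UNIV h"
    using h_lipschitz L_nonneg by (intro lipschitz_onI) (simp_all add: dist_norm)
  then show ?thesis
    by (intro borel_measurable_continuous_onI lipschitz_on_continuous_on)
qed

text \<open>This expresses adaptedness in a form to which Fubini applies. The momentum lags by one
  index because \<open>M t\<close> already involves \<open>\<xi> t\<close>. At \<open>t = 1\<close>
  the history is empty and constants serve.\<close>

lemma iterates_factor_past:
  assumes "t \<ge> 1"
  shows "\<exists>x\<in>borel_measurable (Pi\<^sub>M {1..<t} (\<lambda>_. D)). \<exists>m\<in>borel_measurable (Pi\<^sub>M {1..<t} (\<lambda>_. D)).
    \<forall>\<omega>\<in>space P. X t \<omega> = x (past t \<omega>) \<and> M (t - 1) \<omega> = m (past t \<omega>)"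
  using assms
proof (induction t rule: dec_induct)
  case base
  show ?case
    by (intro bexI[of _ "\<lambda>_. x\<^sub>1"] bexI[of _ "\<lambda>_. 0"]) (auto simp: X_1[simplified] M_0)
next
  case (step t)
  note One_nat_def [simp del]
  have t: "t \<ge> 1" by (rule step.hyps)
  from step.IH obtain x m where x [measurable]: "x \<in> borel_measurable (Pi\<^sub>M {1..<t} (\<lambda>_. D))"
    and m [measurable]: "m \<in> borel_measurable (Pi\<^sub>M {1..<t} (\<lambda>_. D))"
    and eq: "\<And>\<omega>. \<omega> \<in> space P \<Longrightarrow> X t \<omega> = x (past t \<omega>)"
      "\<And>\<omega>. \<omega> \<in> space P \<Longrightarrow> M (t - 1) \<omega> = m (past t \<omega>)"
    by blast
  let ?N = "Pi\<^sub>M {1..<Suc t} (\<lambda>_. D)"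
  define m' where "m' W = \<beta> t *\<^sub>R m (restrict W {1..<t}) +
    (1 - \<beta> t) *\<^sub>R (\<lambda>(y, z). g y z) (x (restrict W {1..<t}), W t)" for W
  define x' where "x' W = x (restrict W {1..<t}) - \<gamma> t *\<^sub>R dir (m' W)" for W
  have r [measurable]: "(\<lambda>W. restrict W {1..<t}) \<in> measurable ?N (Pi\<^sub>M {1..<t} (\<lambda>_. D))"
    by (rule measurable_restrict_subset) auto
  have [measurable]: "(\<lambda>W. W t) \<in> measurable ?N D"
    using t by (intro measurable_component_singleton) auto
  have m' [measurable]: "m' \<in> borel_measurable ?N"
    unfolding m'_def by measurable
  have x': "x' \<in> borel_measurable ?N"
    unfolding x'_def by measurable
  have past: "restrict (past (Suc t) \<omega>) {1..<t} = past t \<omega>" "past (Suc t) \<omega> t = \<xi> t \<omega>" for \<omega>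
    using t by (auto simp: past_def fun_eq_iff)
  have "M t \<omega> = m' (past (Suc t) \<omega>)" if "\<omega> \<in> space P" for \<omega>
    using M_step[OF t that] eq[OF that] by (simp add: m'_def past)
  moreover from this have "X (Suc t) \<omega> = x' (past (Suc t) \<omega>)" if "\<omega> \<in> space P" for \<omega>
    using X_step[OF t that] eq(1)[OF that] that by (simp add: x'_def past flip: Suc_eq_plus1)
  ultimately show ?case
    using m' x' by (intro bexI[of _ x'] bexI[of _ m']) auto
qed

lemma X_measurable [measurable]: "t \<ge> 1 \<Longrightarrow> X t \<in> borel_measurable P"
  and M_prev_measurable: "t \<ge> 1 \<Longrightarrow> M (t - 1) \<in> borel_measurable P"
proof -
  note One_nat_def [simp del]
  assume "t \<ge> 1"
  from iterates_factor_past[OF this]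
  obtain x m where [measurable]: "x \<in> borel_measurable (Pi\<^sub>M {1..<t} (\<lambda>_. D))"
      "m \<in> borel_measurable (Pi\<^sub>M {1..<t} (\<lambda>_. D))"
    and eq: "\<And>\<omega>. \<omega> \<in> space P \<Longrightarrow> X t \<omega> = x (past t \<omega>)"
      "\<And>\<omega>. \<omega> \<in> space P \<Longrightarrow> M (t - 1) \<omega> = m (past t \<omega>)"
    by blast
  have "(\<lambda>\<omega>. x (past t \<omega>)) \<in> borel_measurable P" "(\<lambda>\<omega>. m (past t \<omega>)) \<in> borel_measurable P"
    by measurable
  then show "X t \<in> borel_measurable P" "M (t - 1) \<in> borel_measurable P"
    by (simp_all add: eq cong: measurable_cong)
qed

lemma M_measurable [measurable]: "M t \<in> borel_measurable P"
  using M_prev_measurable[of "Suc t"] by simp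

lemma gradient_sample_measurable [measurable]:
  assumes [measurable]: "t \<ge> 1"
  shows "(\<lambda>\<omega>. g (X t \<omega>) (\<xi> t \<omega>)) \<in> borel_measurable P"
proof -
  have "(\<lambda>\<omega>. (\<lambda>(y, z). g y z) (X t \<omega>, \<xi> t \<omega>)) \<in> borel_measurable P"
    by measurable
  then show ?thesis
    by simp
qed

section \<open>Almost sure bounds and integrability\<close>

lemma M_in_S: "AE \<omega> in P. M t \<omega> \<in> S"
proof (induction t)
  case 0
  show ?case
    using S(3) M_0 by (intro AE_I2) simp
next
  case (Suc t)
  have t: "Suc t \<ge> 1" by simp
  show ?case
    using Suc g_in_S[OF t] AE_space
  proof eventually_elim
    case (elim \<omega>)
    then show ?case
      using M_step[OF t] convexD[OF S(1) elim(1,2)] \<beta>[OF t] by simp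
  qed
qed

lemma X_increment: "t \<ge> 1 \<Longrightarrow> \<omega> \<in> space P \<Longrightarrow> norm (X (t + 1) \<omega> - X t \<omega>) \<le> \<bar>\<gamma> t\<bar> * R"
  using dir_bound by (simp add: X_step[simplified] mult_left_mono)

lemma X_bounded:
  assumes "t \<ge> 1"
  obtains K where "\<And>\<omega>. \<omega> \<in> space P \<Longrightarrow> norm (X t \<omega>) \<le> K"
proof -
  have "\<exists>K. \<forall>\<omega>\<in>space P. norm (X t \<omega>) \<le> K"
    using assms
  proof (induction t rule: dec_induct)
    case base
    then show ?case using X_1 by auto
  next
    case (step t)
    then obtain K where K: "\<And>\<omega>. \<omega> \<in> space P \<Longrightarrow> norm (X t \<omega>) \<le> K" by blast
    have "norm (X (Suc t) \<omega>) \<le> K + \<bar>\<gamma> t\<bar> * R" if "\<omega> \<in> space P" for \<omega>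
      using X_increment[OF step.hyps(1) that] K[OF that] norm_triangle_sub[of "X (Suc t) \<omega>" "X t \<omega>"]
      by simp
    then show ?case by blast
  qed
  then show ?thesis
    using that by blast
qed

lemma h_X_bounded:
  assumes "t \<ge> 1"
  obtains K where "\<And>\<omega>. \<omega> \<in> space P \<Longrightarrow> norm (h (X t \<omega>)) \<le> K"
proof -
  obtain K where K: "\<And>\<omega>. \<omega> \<in> space P \<Longrightarrow> norm (X t \<omega>) \<le> K"
    using X_bounded[OF assms] by blast
  have "norm (h (X t \<omega>)) \<le> norm (h 0) + L * K" if "\<omega> \<in> space P" for \<omega>
    using h_lipschitz[of "X t \<omega>" 0] mult_left_mono[OF K[OF that] L_nonneg]
      norm_triangle_sub[of "h (X t \<omega>)" "h 0"] by simp
  then show ?thesis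
    using that by blast
qed

lemma integrable_norm_h_X: "t \<ge> 1 \<Longrightarrow> integrable P (\<lambda>\<omega>. norm (h (X t \<omega>)))"
proof -
  assume t [measurable]: "t \<ge> 1"
  obtain K where "\<And>\<omega>. \<omega> \<in> space P \<Longrightarrow> norm (h (X t \<omega>)) \<le> K"
    using h_X_bounded[OF t] by blast
  then show ?thesis
    by (intro P.integrable_const_bound[where B = K]) auto
qed

lemma AE_bounded_diff_h_X:
  assumes t: "t \<ge> 1" and Y: "AE \<omega> in P. Y \<omega> \<in> S"
  obtains K where "K \<ge> 0" "AE \<omega> in P. norm (Y \<omega> - h (X t \<omega>)) \<le> K"
proof -
  obtain K where K: "\<And>\<omega>. \<omega> \<in> space P \<Longrightarrow> norm (h (X t \<omega>)) \<le> K"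
    using h_X_bounded[OF t] by blast
  obtain C where C: "\<And>y. y \<in> S \<Longrightarrow> norm y \<le> C"
    using S(2) by (auto simp: bounded_iff)
  have "AE \<omega> in P. norm (Y \<omega> - h (X t \<omega>)) \<le> \<bar>C + K\<bar>"
    using Y AE_space
  proof eventually_elim
    case (elim \<omega>)
    then show ?case
      using C[of "Y \<omega>"] K[of \<omega>] norm_triangle_ineq4[of "Y \<omega>" "h (X t \<omega>)"] by linarith
  qed
  then show ?thesis
    using that[of "\<bar>C + K\<bar>"] by simp
qed

lemma integrable_inner_diff_h_X:
  assumes t [measurable]: "t \<ge> 1" "t' \<ge> 1"
    and Y: "AE \<omega> in P. Y \<omega> \<in> S" and Z: "AE \<omega> in P. Z \<omega> \<in> S"
    and [measurable]: "Y \<in> borel_measurable P" "Z \<in> borel_measurable P"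
  shows "integrable P (\<lambda>\<omega>. (Y \<omega> - h (X t \<omega>)) \<bullet> (Z \<omega> - h (X t' \<omega>)))"
proof -
  obtain K where K: "K \<ge> 0" "AE \<omega> in P. norm (Y \<omega> - h (X t \<omega>)) \<le> K"
    using AE_bounded_diff_h_X[OF t(1) Y] by blast
  obtain K' where K': "AE \<omega> in P. norm (Z \<omega> - h (X t' \<omega>)) \<le> K'"
    using AE_bounded_diff_h_X[OF t(2) Z] by blast
  have "AE \<omega> in P. norm ((Y \<omega> - h (X t \<omega>)) \<bullet> (Z \<omega> - h (X t' \<omega>))) \<le> K * K'"
    using K(2) K'
  proof eventually_elim
    case (elim \<omega>)
    have "norm ((Y \<omega> - h (X t \<omega>)) \<bullet> (Z \<omega> - h (X t' \<omega>))) \<le>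
        norm (Y \<omega> - h (X t \<omega>)) * norm (Z \<omega> - h (X t' \<omega>))"
      using Cauchy_Schwarz_ineq2 by simp
    also have "\<dots> \<le> K * K'"
      using elim K(1) by (intro mult_mono) auto
    finally show ?case .
  qed
  then show ?thesis
    by (intro P.integrable_const_bound[where B = "K * K'"]) auto
qed

lemmas integrable_norm_sq_diff_h_X =
  integrable_inner_diff_h_X[where Y = Y and Z = Y and t = t and t' = t for Y t,
    folded power2_norm_eq_inner]

text \<open>A tower property: by independence the joint law is a product, so the new sample can be
  integrated out first with the history frozen.\<close>

lemma expectation_past_sample:
  fixes k :: "(nat \<Rightarrow> 's) \<times> 's \<Rightarrow> real"
  assumes t: "t \<ge> 1" and k [measurable]: "k \<in> borel_measurable (Pi\<^sub>M {1..<t} (\<lambda>_. D) \<Otimes>\<^sub>M D)"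
    and int: "integrable P (\<lambda>\<omega>. k (past t \<omega>, \<xi> t \<omega>))"
  shows "integrable P (\<lambda>\<omega>. \<integral>z. k (past t \<omega>, z) \<partial>D)"
    and "(\<integral>\<omega>. k (past t \<omega>, \<xi> t \<omega>) \<partial>P) = (\<integral>\<omega>. (\<integral>z. k (past t \<omega>, z) \<partial>D) \<partial>P)"
proof -
  note One_nat_def [simp del]
  let ?PS = "Pi\<^sub>M {1..<t} (\<lambda>_. D)" and ?PV = "Pi\<^sub>M {t} (\<lambda>_. D)"
  \<comment> \<open>The single sample is repackaged as a one-point family, since independence is
    available for restrictions to disjoint index sets; \<open>k'\<close> reads off its only
    component.\<close>
  define V where "V \<omega> = (\<lambda>i\<in>{t}. \<xi> i \<omega>)" for \<omega>
  let ?N = "distr P ?PS (past t)" and ?N' = "distr P ?PV V"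
  define k' where "k' p = k (fst p, snd p t)" for p
  note [measurable] = \<xi>_measurable[OF t]
  have V [measurable]: "V \<in> measurable P ?PV"
    unfolding V_def by (rule measurable_restrict) simp
  have [measurable]: "(\<lambda>v. v t) \<in> measurable ?PV D"
    by (intro measurable_component_singleton) simp
  have k' [measurable]: "k' \<in> borel_measurable (?PS \<Otimes>\<^sub>M ?PV)"
    unfolding k'_def by measurable
  have "P.indep_var ?PS (past t) ?PV V"
    unfolding past_def[abs_def] V_def[abs_def]
    by (rule P.indep_var_restrict[OF \<xi>_indep]) (use t in auto)
  then have joint: "distr P (?PS \<Otimes>\<^sub>M ?PV) (\<lambda>\<omega>. (past t \<omega>, V \<omega>)) = ?N \<Otimes>\<^sub>M ?N'"
    by (simp add: P.indep_var_distribution_eq)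
  interpret N: prob_space ?N
    by (rule P.prob_space_distr) measurable
  interpret N': prob_space ?N'
    by (rule P.prob_space_distr) measurable
  interpret NN': pair_sigma_finite ?N ?N' ..
  have k'V: "k' (past t \<omega>, V \<omega>) = k (past t \<omega>, \<xi> t \<omega>)" for \<omega>
    by (simp add: k'_def V_def)
  have int': "integrable (?N \<Otimes>\<^sub>M ?N') k'"
    unfolding joint[symmetric] by (subst integrable_distr_eq) (use int k'V in auto)
  have inner [measurable]: "(\<lambda>W. \<integral>z. k (W, z) \<partial>D) \<in> borel_measurable ?PS"
    by measurable
  have inner_eq: "(\<integral>v. k' (W, v) \<partial>?N') = (\<integral>z. k (W, z) \<partial>D)" if "W \<in> space ?PS" for W
  proof -
    have [measurable]: "(\<lambda>z. k (W, z)) \<in> borel_measurable D"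
      using that by measurable
    have "(\<integral>v. k' (W, v) \<partial>?N') = (\<integral>\<omega>. k (W, \<xi> t \<omega>) \<partial>P)"
      unfolding k'_def by (subst integral_distr) (simp_all add: V_def)
    also have "\<dots> = (\<integral>z. k (W, z) \<partial>distr P D (\<xi> t))"
      by (subst integral_distr) auto
    finally show ?thesis
      by (simp only: \<xi>_distr[OF t])
  qed
  have "integrable ?N (\<lambda>W. \<integral>v. k' (W, v) \<partial>?N')"
    by (rule NN'.integrable_fst'[OF int'])
  then have "integrable ?N (\<lambda>W. \<integral>z. k (W, z) \<partial>D)"
    by (rule Bochner_Integration.integrable_cong[THEN iffD1, OF refl, rotated]) (simp add: inner_eq)
  then show "integrable P (\<lambda>\<omega>. \<integral>z. k (past t \<omega>, z) \<partial>D)"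
    by (subst (asm) integrable_distr_eq) auto
  have "(\<integral>\<omega>. k (past t \<omega>, \<xi> t \<omega>) \<partial>P) = integral\<^sup>L (?N \<Otimes>\<^sub>M ?N') k'"
    unfolding joint[symmetric] by (subst integral_distr) (auto simp: k'V)
  also have "\<dots> = (\<integral>W. (\<integral>v. k' (W, v) \<partial>?N') \<partial>?N)"
    by (rule NN'.integral_fst'[OF int', symmetric])
  also have "\<dots> = (\<integral>W. (\<integral>z. k (W, z) \<partial>D) \<partial>?N)"
    by (rule Bochner_Integration.integral_cong[OF refl]) (simp add: inner_eq)
  also have "\<dots> = (\<integral>\<omega>. (\<integral>z. k (past t \<omega>, z) \<partial>D) \<partial>P)"
    by (subst integral_distr) auto
  finally show "(\<integral>\<omega>. k (past t \<omega>, \<xi> t \<omega>) \<partial>P) = (\<integral>\<omega>. (\<integral>z. k (past t \<omega>, z) \<partial>D) \<partial>P)" .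
qed

section \<open>Second moment of the momentum error\<close>

lemma integrable_momentum_error_sq:
  "t \<ge> 1 \<Longrightarrow> integrable P (\<lambda>\<omega>. (norm (M t \<omega> - h (X t \<omega>)))\<^sup>2)"
  by (intro integrable_norm_sq_diff_h_X M_in_S M_measurable)

lemma expectation_momentum_error_le:
  assumes t [measurable]: "t \<ge> 1"
  shows "(\<integral>\<omega>. (norm (M t \<omega> - h (X t \<omega>)))\<^sup>2 \<partial>P)
    \<le> (\<beta> t)\<^sup>2 * (\<integral>\<omega>. (norm (M (t - 1) \<omega> - h (X t \<omega>)))\<^sup>2 \<partial>P) + (1 - \<beta> t)\<^sup>2 * \<sigma>\<^sup>2"
proof -
  note One_nat_def [simp del]
  \<comment> \<open>The error is \<open>\<beta> t *\<^sub>R U + (1 - \<beta> t) *\<^sub>R N\<close>,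
    where \<open>U\<close> depends on the past only and \<open>N\<close> is the fresh noise.\<close>
  define U where "U \<omega> = M (t - 1) \<omega> - h (X t \<omega>)" for \<omega>
  define N where "N \<omega> = g (X t \<omega>) (\<xi> t \<omega>) - h (X t \<omega>)" for \<omega>
  from iterates_factor_past[OF t]
  obtain x m where [measurable]: "x \<in> borel_measurable (Pi\<^sub>M {1..<t} (\<lambda>_. D))"
      "m \<in> borel_measurable (Pi\<^sub>M {1..<t} (\<lambda>_. D))"
    and eq: "\<And>\<omega>. \<omega> \<in> space P \<Longrightarrow> X t \<omega> = x (past t \<omega>)"
      "\<And>\<omega>. \<omega> \<in> space P \<Longrightarrow> M (t - 1) \<omega> = m (past t \<omega>)"
    by blast
  have gx: "(\<lambda>p. g (x (fst p)) (snd p)) \<in> borel_measurable (Pi\<^sub>M {1..<t} (\<lambda>_. D) \<Otimes>\<^sub>M D)"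
  proof -
    have "(\<lambda>p. (\<lambda>(y, z). g y z) (x (fst p), snd p)) \<in> borel_measurable (Pi\<^sub>M {1..<t} (\<lambda>_. D) \<Otimes>\<^sub>M D)"
      by measurable
    then show ?thesis
      by simp
  qed
  note [measurable] = gx
  note gm = gradient_sample_measurable[OF t] and gS = g_in_S[OF t]
  have int_UU: "integrable P (\<lambda>\<omega>. (norm (U \<omega>))\<^sup>2)"
    unfolding U_def by (intro integrable_norm_sq_diff_h_X t M_in_S M_measurable)
  have int_NN: "integrable P (\<lambda>\<omega>. (norm (N \<omega>))\<^sup>2)"
    unfolding N_def by (intro integrable_norm_sq_diff_h_X t gm gS)
  have int_UN: "integrable P (\<lambda>\<omega>. U \<omega> \<bullet> N \<omega>)"
    unfolding U_def N_def by (intro integrable_inner_diff_h_X t M_in_S M_measurable gm gS)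
  have UN: "(\<integral>\<omega>. U \<omega> \<bullet> N \<omega> \<partial>P) = 0"
  proof -
    define k where "k p = (m (fst p) - h (x (fst p))) \<bullet> (g (x (fst p)) (snd p) - h (x (fst p)))" for p
    have [measurable]: "k \<in> borel_measurable (Pi\<^sub>M {1..<t} (\<lambda>_. D) \<Otimes>\<^sub>M D)"
      unfolding k_def by measurable
    have k: "U \<omega> \<bullet> N \<omega> = k (past t \<omega>, \<xi> t \<omega>)" if "\<omega> \<in> space P" for \<omega>
      using that by (simp add: U_def N_def k_def eq)
    have "(\<integral>\<omega>. U \<omega> \<bullet> N \<omega> \<partial>P) = (\<integral>\<omega>. k (past t \<omega>, \<xi> t \<omega>) \<partial>P)"
      using k by (rule Bochner_Integration.integral_cong[OF refl])
    also have "\<dots> = (\<integral>\<omega>. (\<integral>z. k (past t \<omega>, z) \<partial>D) \<partial>P)"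
    proof (rule expectation_past_sample(2)[OF t])
      show "integrable P (\<lambda>\<omega>. k (past t \<omega>, \<xi> t \<omega>))"
        using int_UN k by (simp cong: Bochner_Integration.integrable_cong)
    qed measurable
    also have "\<dots> = 0"
    proof -
      \<comment> \<open>With the history \<open>W\<close> frozen, the first factor of
        \<open>k\<close> is constant and unbiasedness at \<open>x W\<close> annihilates the
        second.\<close>
      have "(\<integral>z. k (W, z) \<partial>D) = 0" for W
        using g_integrable[of "x W"] by (simp add: k_def unbiased D.prob_space)
      then show ?thesis
        by simp
    qed
    finally show ?thesis .
  qed
  have NN: "(\<integral>\<omega>. (norm (N \<omega>))\<^sup>2 \<partial>P) \<le> \<sigma>\<^sup>2"
  proof -
    define k where "k p = (norm (g (x (fst p)) (snd p) - h (x (fst p))))\<^sup>2" for p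
    have km [measurable]: "k \<in> borel_measurable (Pi\<^sub>M {1..<t} (\<lambda>_. D) \<Otimes>\<^sub>M D)"
      unfolding k_def by measurable
    have k: "(norm (N \<omega>))\<^sup>2 = k (past t \<omega>, \<xi> t \<omega>)" if "\<omega> \<in> space P" for \<omega>
      using that by (simp add: N_def k_def eq)
    have int_k: "integrable P (\<lambda>\<omega>. k (past t \<omega>, \<xi> t \<omega>))"
      using int_NN k by (simp cong: Bochner_Integration.integrable_cong)
    have "(\<integral>\<omega>. (norm (N \<omega>))\<^sup>2 \<partial>P) = (\<integral>\<omega>. k (past t \<omega>, \<xi> t \<omega>) \<partial>P)"
      using k by (rule Bochner_Integration.integral_cong[OF refl])
    also have "\<dots> = (\<integral>\<omega>. (\<integral>z. k (past t \<omega>, z) \<partial>D) \<partial>P)"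
      by (rule expectation_past_sample(2)[OF t km int_k])
    also have "\<dots> \<le> \<sigma>\<^sup>2"
      using variance
      by (intro P.integral_le_const expectation_past_sample(1)[OF t km int_k] AE_I2) (simp add: k_def)
    finally show ?thesis .
  qed
  have "(norm (M t \<omega> - h (X t \<omega>)))\<^sup>2 =
      (\<beta> t)\<^sup>2 * (norm (U \<omega>))\<^sup>2 + (1 - \<beta> t)\<^sup>2 * (norm (N \<omega>))\<^sup>2 + 2 * \<beta> t * (1 - \<beta> t) * (U \<omega> \<bullet> N \<omega>)"
    if "\<omega> \<in> space P" for \<omega>
  proof -
    have "M t \<omega> - h (X t \<omega>) = \<beta> t *\<^sub>R U \<omega> + (1 - \<beta> t) *\<^sub>R N \<omega>"
      using M_step[OF t that] by (simp add: U_def N_def algebra_simps)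
    then show ?thesis
      by (simp only: norm_sq_linear_combination)
  qed
  then have "(\<integral>\<omega>. (norm (M t \<omega> - h (X t \<omega>)))\<^sup>2 \<partial>P) = (\<integral>\<omega>. (\<beta> t)\<^sup>2 * (norm (U \<omega>))\<^sup>2 +
      (1 - \<beta> t)\<^sup>2 * (norm (N \<omega>))\<^sup>2 + 2 * \<beta> t * (1 - \<beta> t) * (U \<omega> \<bullet> N \<omega>) \<partial>P)"
    by (rule Bochner_Integration.integral_cong[OF refl])
  also have "\<dots> = (\<beta> t)\<^sup>2 * (\<integral>\<omega>. (norm (U \<omega>))\<^sup>2 \<partial>P) + (1 - \<beta> t)\<^sup>2 * (\<integral>\<omega>. (norm (N \<omega>))\<^sup>2 \<partial>P)"
    using int_UU int_NN int_UN by (simp add: UN)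
  also have "\<dots> \<le> (\<beta> t)\<^sup>2 * (\<integral>\<omega>. (norm (U \<omega>))\<^sup>2 \<partial>P) + (1 - \<beta> t)\<^sup>2 * \<sigma>\<^sup>2"
    using NN by (intro add_left_mono mult_left_mono) auto
  finally show ?thesis
    by (simp add: U_def)
qed

text \<open>The old momentum is measured against the gradient at the new point, which costs a drift
  of at most \<open>L * \<bar>\<gamma> (t - 1)\<bar> * R\<close>. Splitting the square with weights
  \<open>1 + \<alpha>\<close> and \<open>1 + 1 / \<alpha>\<close> is affordable because the factor
  \<open>(1 - \<alpha>)^2\<close> from the averaging absorbs it.\<close>

lemma expectation_momentum_error_recursion:
  assumes t: "t \<ge> 2" and \<alpha>: "0 < \<alpha>" "\<beta> t = 1 - \<alpha>"
  shows "(\<integral>\<omega>. (norm (M t \<omega> - h (X t \<omega>)))\<^sup>2 \<partial>P)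
    \<le> (1 - \<alpha>) * (\<integral>\<omega>. (norm (M (t - 1) \<omega> - h (X (t - 1) \<omega>)))\<^sup>2 \<partial>P)
      + (L * \<gamma> (t - 1) * R)\<^sup>2 / \<alpha> + \<alpha>\<^sup>2 * \<sigma>\<^sup>2"
proof -
  have t1: "t \<ge> 1" "t - 1 \<ge> 1"
    using t by auto
  have \<alpha>1: "\<alpha> \<le> 1"
    using \<beta>(1)[OF t1(1)] \<alpha> by simp
  define e where "e = (\<integral>\<omega>. (norm (M (t - 1) \<omega> - h (X (t - 1) \<omega>)))\<^sup>2 \<partial>P)"
  define \<delta> where "\<delta> = (L * \<gamma> (t - 1) * R)\<^sup>2"
  have e: "0 \<le> e" by (simp add: e_def)
  have \<delta>: "0 \<le> \<delta>" by (simp add: \<delta>_def)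
  have pointwise: "(norm (M (t - 1) \<omega> - h (X t \<omega>)))\<^sup>2 \<le>
      (1 + \<alpha>) * (norm (M (t - 1) \<omega> - h (X (t - 1) \<omega>)))\<^sup>2 + (1 + 1 / \<alpha>) * \<delta>"
    if \<omega>: "\<omega> \<in> space P" for \<omega>
  proof -
    let ?a = "norm (M (t - 1) \<omega> - h (X (t - 1) \<omega>))"
    define b where "b = norm (h (X (t - 1) \<omega>) - h (X t \<omega>))"
    have "b \<le> L * norm (X (t - 1) \<omega> - X t \<omega>)"
      unfolding b_def by (rule h_lipschitz)
    also have "\<dots> \<le> L * (\<bar>\<gamma> (t - 1)\<bar> * R)"
      using X_increment[OF t1(2) \<omega>] t1 L_nonneg
      by (intro mult_left_mono) (simp_all add: norm_minus_commute)
    finally have "b\<^sup>2 \<le> (L * (\<bar>\<gamma> (t - 1)\<bar> * R))\<^sup>2"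
      by (intro power_mono) (simp_all add: b_def)
    then have b: "b\<^sup>2 \<le> \<delta>"
      by (simp add: \<delta>_def power_mult_distrib)
    have "norm (M (t - 1) \<omega> - h (X t \<omega>)) \<le> ?a + b"
      using norm_triangle_ineq[of "M (t - 1) \<omega> - h (X (t - 1) \<omega>)" "h (X (t - 1) \<omega>) - h (X t \<omega>)"]
      by (simp add: b_def)
    then have "(norm (M (t - 1) \<omega> - h (X t \<omega>)))\<^sup>2 \<le> (?a + b)\<^sup>2"
      by (intro power_mono) auto
    also have "\<dots> \<le> (1 + \<alpha>) * ?a\<^sup>2 + (1 + 1 / \<alpha>) * b\<^sup>2"
    proof -
      have "0 \<le> (\<alpha> * ?a - b)\<^sup>2 / \<alpha>"
        using \<alpha> by simp
      also have "\<dots> = \<alpha> * ?a\<^sup>2 + b\<^sup>2 / \<alpha> - 2 * ?a * b"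
        using \<alpha> by (simp add: power2_eq_square field_simps)
      finally show ?thesis
        by (simp add: power2_eq_square algebra_simps)
    qed
    also have "\<dots> \<le> (1 + \<alpha>) * ?a\<^sup>2 + (1 + 1 / \<alpha>) * \<delta>"
      using b \<alpha> by (intro add_left_mono mult_left_mono) auto
    finally show ?thesis .
  qed
  have int: "integrable P (\<lambda>\<omega>. (norm (M (t - 1) \<omega> - h (X (t - 1) \<omega>)))\<^sup>2)"
    by (rule integrable_momentum_error_sq[OF t1(2)])
  have "(\<integral>\<omega>. (norm (M (t - 1) \<omega> - h (X t \<omega>)))\<^sup>2 \<partial>P) \<le>
      (\<integral>\<omega>. (1 + \<alpha>) * (norm (M (t - 1) \<omega> - h (X (t - 1) \<omega>)))\<^sup>2 + (1 + 1 / \<alpha>) * \<delta> \<partial>P)"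
    using pointwise int t1
    by (intro integral_mono integrable_norm_sq_diff_h_X M_in_S M_measurable) auto
  also have "\<dots> = (1 + \<alpha>) * e + (1 + 1 / \<alpha>) * \<delta>"
    using int by (simp add: e_def P.prob_space)
  finally have "(\<beta> t)\<^sup>2 * (\<integral>\<omega>. (norm (M (t - 1) \<omega> - h (X t \<omega>)))\<^sup>2 \<partial>P) \<le>
      (\<beta> t)\<^sup>2 * ((1 + \<alpha>) * e + (1 + 1 / \<alpha>) * \<delta>)"
    by (intro mult_left_mono) auto
  \<comment> \<open>Since \<open>1 + 1 / \<alpha> = (1 + \<alpha>) / \<alpha>\<close>, both terms
    carry the same factor \<open>(1 - \<alpha>)^2 (1 + \<alpha>)\<close>, which is at most
    \<open>1 - \<alpha>\<close>.\<close>
  also have "\<dots> = ((1 - \<alpha>)\<^sup>2 * (1 + \<alpha>)) * e + ((1 - \<alpha>)\<^sup>2 * (1 + \<alpha>)) * (\<delta> / \<alpha>)"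
    unfolding \<alpha>(2) using \<alpha>(1) by (simp add: field_simps)
  also have "\<dots> \<le> (1 - \<alpha>) * e + 1 * (\<delta> / \<alpha>)"
  proof -
    have "(1 - \<alpha>)\<^sup>2 * (1 + \<alpha>) = (1 - \<alpha>) * (1 - \<alpha>\<^sup>2)"
      by (simp add: power2_eq_square algebra_simps)
    also have "\<dots> \<le> (1 - \<alpha>) * 1"
      using \<alpha>1 by (intro mult_left_mono) auto
    finally have *: "(1 - \<alpha>)\<^sup>2 * (1 + \<alpha>) \<le> 1 - \<alpha>"
      by simp
    then have "(1 - \<alpha>)\<^sup>2 * (1 + \<alpha>) \<le> 1"
      using \<alpha> by linarith
    with * show ?thesis
      using e \<delta> \<alpha> by (intro add_mono mult_right_mono) auto
  qed
  finally show ?thesis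
    using expectation_momentum_error_le[OF t1(1)] by (simp add: e_def \<delta>_def \<alpha>(2))
qed

end

section \<open>The convergence rate\<close>

text \<open>\<open>(x + 1) / (2 x)\<close> decreases to 5/6 at 3/2, and the subtracted term is
  largest at the corner \<open>x = y = 3/2\<close>, with value 11/16. The third claim ties
  \<open>\<chi>\<^sub>\<epsilon>\<close> to the alignment constant.\<close>

lemma chi_bounds:
  fixes x y :: real
  assumes x: "1 \<le> x" "x \<le> 3 / 2" and y: "1 \<le> y" "y \<le> 3 / 2"
  defines "c \<equiv> (x + 1) * (y + 1) / (4 * x * y) - (3 * x * y - x - y - 1) / 4"
  shows "1 / 144 \<le> c" "x * y \<le> (x + 1) * (y + 1) / 2"
    "c \<le> ((x + 1) * (y + 1) / 2 - x * y) / (x * y)"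
proof -
  have "5 / 6 * (5 / 6) \<le> ((x + 1) / (2 * x)) * ((y + 1) / (2 * y))"
    using x y by (intro mult_mono) (auto simp: field_simps)
  moreover have "((x + 1) / (2 * x)) * ((y + 1) / (2 * y)) = (x + 1) * (y + 1) / (4 * x * y)"
    by simp
  ultimately have 1: "25 / 36 \<le> (x + 1) * (y + 1) / (4 * x * y)"
    by simp
  have "x * (3 * y - 1) \<le> 3 / 2 * (3 * y - 1)"
    using x y by (intro mult_right_mono) auto
  then have "3 * x * y - x - y - 1 \<le> 11 / 4"
    using y by (simp add: algebra_simps)
  then have 2: "(3 * x * y - x - y - 1) / 4 \<le> 11 / 16"
    by simp
  show "1 / 144 \<le> c"
    using diff_mono[OF 1 2] by (simp add: c_def)
  have "x * (y - 1) \<le> x * (1 / 2)"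
    using x y by (intro mult_left_mono) auto
  then have "x * y \<le> x + x / 2"
    unfolding right_diff_distrib by linarith
  moreover have "(x + 1) * (y + 1) = x * y + x + y + 1"
    by (simp add: algebra_simps)
  ultimately show "x * y \<le> (x + 1) * (y + 1) / 2"
    using x y by linarith
  have xy: "1 \<le> x * y"
    using mult_mono[of 1 x 1 y] x y by simp
  have "x \<le> x * y" "y \<le> x * y"
    using x y by (simp_all add: mult_le_cancel_left1 mult_le_cancel_right1)
  then have d: "0 \<le> x * y - (x + 1) * (y + 1) / 4"
    using xy by (simp add: field_simps)
  \<comment> \<open>One half of the first fraction is kept and the other joined to -1; dropping the
    division by \<open>x * y \<ge> 1\<close> from that nonnegative deficit gives the stated
    \<open>c\<close>.\<close>
  have "((x + 1) * (y + 1) / 2 - x * y) / (x * y) =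
      (x + 1) * (y + 1) / (4 * x * y) - (x * y - (x + 1) * (y + 1) / 4) / (x * y)"
    using xy x y by (simp add: field_simps)
  moreover have "(x * y - (x + 1) * (y + 1) / 4) / (x * y) \<le> (x * y - (x + 1) * (y + 1) / 4) / 1"
    using xy d by (intro divide_left_mono) auto
  moreover have "(x * y - (x + 1) * (y + 1) / 4) / 1 = (3 * x * y - x - y - 1) / 4"
    by (simp add: field_simps)
  ultimately show "c \<le> ((x + 1) * (y + 1) / 2 - x * y) / (x * y)"
    unfolding c_def by linarith
qed

lemma sqrt_one_plus_bounds:
  assumes "4 / 5 * k \<le> \<epsilon>" "0 < \<epsilon>" "0 \<le> c" "c \<le> (k :: real)"
  shows "1 \<le> sqrt (1 + c / \<epsilon>)" "sqrt (1 + c / \<epsilon>) \<le> 3 / 2"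
proof -
  show "1 \<le> sqrt (1 + c / \<epsilon>)"
    using assms by simp
  have "c / \<epsilon> \<le> 5 / 4"
    using assms by (simp add: field_simps)
  then show "sqrt (1 + c / \<epsilon>) \<le> 3 / 2"
    by (intro real_le_lsqrt) (auto simp: power2_eq_square)
qed

text \<open>Because \<open>t - 1 \<ge> t / 2\<close> from \<open>t = 2\<close> on, the index shift
  costs \<open>2 powr (3 / 2)\<close>, the source of \<open>2 * sqrt 2\<close> in
  \<open>C\<^sub>1\<close>.\<close>

lemma powr_pred_le:
  assumes "t \<ge> 2"
  shows "real (t - 1) powr (- 3 / 2) \<le> 2 * sqrt 2 * real t powr (- 3 / 2)"
proof -
  have "real (t - 1) powr (- 3 / 2) \<le> (real t / 2) powr (- 3 / 2)"
    using assms by (intro powr_mono2') (auto simp: field_simps)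
  also have "\<dots> = real t powr (- 3 / 2) / 2 powr (- 3 / 2)"
    using assms by (subst powr_divide) auto
  also have "(2 :: real) powr (- 3 / 2) = 1 / 2 powr (1 + 1 / 2)"
    by (simp add: powr_minus_divide[symmetric])
  also have "(2 :: real) powr (1 + 1 / 2) = 2 * sqrt 2"
    by (subst powr_add) (simp add: powr_half_sqrt)
  finally show ?thesis
    by (simp add: mult.commute)
qed

text \<open>Read at \<open>t + 1\<close>, the recursion bounds the contracted part of
  \<open>e t\<close> by the decrease \<open>e t - e (t + 1)\<close> plus \<open>K / t\<close>, so
  the sum telescopes.\<close>

lemma weighted_error_sum_le:
  fixes e :: "nat \<Rightarrow> real"
  assumes e: "\<And>t. 0 \<le> e t" "e 1 \<le> s" and K: "0 \<le> K"
    and rec: "\<And>t. t \<ge> 2 \<Longrightarrow> e t \<le> (1 - real t powr (- 1 / 2)) * e (t - 1) + K / real t"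
    and T: "T \<ge> 1"
  shows "(\<Sum>t=1..T. real t powr (- 1 / 2) * e t) \<le> sqrt 2 * (s + K * (1 + ln (real T)))"
proof -
  have telescope: "real (t + 1) powr (- 1 / 2) * e t \<le> e t - e (t + 1) + K / real t" if "t \<ge> 1" for t
  proof -
    have "K / real (t + 1) \<le> K / real t"
      using K that by (intro divide_left_mono) auto
    with rec[of "t + 1"] that show ?thesis
      by (simp add: algebra_simps)
  qed
  have "(\<Sum>t=1..T. real (t + 1) powr (- 1 / 2) * e t) \<le> e 1 - e (T + 1) + K * (\<Sum>t=1..T. 1 / real t)"
    using T
  proof (induction T rule: dec_induct)
    case base
    then show ?case using telescope[of 1] by simp
  next
    case (step T)
    then show ?case
      using telescope[of "Suc T"] by (simp add: distrib_left)
  qed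
  also have "\<dots> \<le> s + K * (1 + ln (real T))"
    using e(2) e(1)[of "T + 1"] mult_left_mono[OF harm_le_ln[OF T] K] by linarith
  finally have *: "(\<Sum>t=1..T. real (t + 1) powr (- 1 / 2) * e t) \<le> s + K * (1 + ln (real T))" .
  \<comment> \<open>The telescoped sum carries the weight of index \<open>t + 1\<close>; as
    \<open>t + 1 \<le> 2 t\<close>, returning to index \<open>t\<close> costs the factor
    \<open>sqrt 2\<close>.\<close>
  have "(\<Sum>t=1..T. real t powr (- 1 / 2) * e t) \<le>
      (\<Sum>t=1..T. sqrt 2 * (real (t + 1) powr (- 1 / 2) * e t))"
  proof (rule sum_mono)
    fix t assume "t \<in> {1..T}"
    then have t: "t \<ge> 1" by simp
    have "real t powr (- 1 / 2) = sqrt 2 * (2 * real t) powr (- 1 / 2)"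
      using t by (subst powr_mult) (auto simp: powr_minus_divide powr_half_sqrt)
    also have "\<dots> \<le> sqrt 2 * real (t + 1) powr (- 1 / 2)"
      using t by (intro mult_left_mono powr_mono2') auto
    finally have "real t powr (- 1 / 2) \<le> sqrt 2 * real (t + 1) powr (- 1 / 2)" .
    from mult_right_mono[OF this e(1)[of t]]
    show "real t powr (- 1 / 2) * e t \<le> sqrt 2 * (real (t + 1) powr (- 1 / 2) * e t)"
      by (simp add: mult.assoc)
  qed
  also have "\<dots> = sqrt 2 * (\<Sum>t=1..T. real (t + 1) powr (- 1 / 2) * e t)"
    by (simp only: sum_distrib_left)
  also have "\<dots> \<le> sqrt 2 * (s + K * (1 + ln (real T)))"
    using * by (intro mult_left_mono) auto
  finally show ?thesis .
qed

text \<open>The step size is split as \<open>t powr (- 1 / 2)\<close> times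
  \<open>t powr (- 1 / 4)\<close>: squared, the first factor gives the harmonic term and the second
  exactly the weight under which the squared errors are summable up to a logarithm.\<close>

lemma Young_step_size:
  assumes L: "L > 0" and t: "t \<ge> (1 :: nat)"
  shows "real t powr (- 3 / 4) * c * E
    \<le> L * c\<^sup>2 / 2 * (1 / real t) + 1 / (2 * L) * (real t powr (- 1 / 2) * E\<^sup>2)"
proof -
  define p q where "p = real t powr (- 1 / 2)" and "q = real t powr (- 1 / 4)"
  have pp: "p * p = 1 / real t"
    using t unfolding p_def by (subst powr_add[symmetric]) (simp add: powr_minus_divide)
  have qq: "q * q = p"
    using t unfolding p_def q_def by (subst powr_add[symmetric]) simp
  have pq: "p * q = real t powr (- 3 / 4)"
    using t unfolding p_def q_def by (subst powr_add[symmetric]) simp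
  have "0 \<le> (L * c * p - q * E)\<^sup>2 / (2 * L)"
    using L by simp
  also have "\<dots> = L * c\<^sup>2 / 2 * (p * p) + 1 / (2 * L) * ((q * q) * E\<^sup>2) - (p * q) * c * E"
    using L by (simp add: power2_eq_square field_simps)
  finally show ?thesis
    unfolding pp qq pq by (simp add: p_def)
qed

theorem proposition3p4:
  fixes f :: "real ^ 'n ^ 'm \<Rightarrow> real"
    and F :: "real ^ 'n ^ 'm \<Rightarrow> 's \<Rightarrow> real"
    and D :: "'s measure"
    and P :: "'w measure"
    and \<xi> :: "nat \<Rightarrow> 'w \<Rightarrow> 's"
    and X G M Q :: "nat \<Rightarrow> 'w \<Rightarrow> real ^ 'n ^ 'm"
    and X\<^sub>1 :: "real ^ 'n ^ 'm"
    and \<eta> \<beta> :: "nat \<Rightarrow> real"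
    and f_star L \<sigma> a \<epsilon> G_inf \<rho>\<^sub>r \<rho>\<^sub>c \<chi>\<^sub>\<epsilon> C\<^sub>1 C\<^sub>2 m n :: real
  assumes m_def: "m = real CARD('m)"
    and n_def: "n = real CARD('n)"
    and m_ge_n: "m \<ge> n"
    \<comment> \<open>the stochastic objective \<open>f X = E f(X; \<xi>)\<close>, with \<open>F X z\<close> standing for \<open>f(X; z)\<close>\<close>
    and D_prob: "prob_space D"
    and F_integrable: "\<And>Y. integrable D (F Y)"
    and f_eq: "\<And>Y. f Y = (\<integral>z. F Y z \<partial>D)"
    and F_diff: "\<And>Y z. z \<in> space D \<Longrightarrow> (\<lambda>Y'. F Y' z) differentiable (at Y)"
    and f_diff: "\<And>Y. f differentiable (at Y)"
    \<comment> \<open>assumptions (1)-(3)\<close>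
    and f_bounded_below: "\<And>Y. f Y \<ge> f_star"
    and L_pos: "L > 0"
    and smooth: "\<And>Y Z. norm (grad f Z - grad f Y) \<le> L * norm (Z - Y)"
    and sigma_pos: "\<sigma> > 0"
    and grad_integrable: "\<And>Y. integrable D (\<lambda>z. grad (\<lambda>Y'. F Y' z) Y)"
    and unbiased: "\<And>Y. (\<integral>z. grad (\<lambda>Y'. F Y' z) Y \<partial>D) = grad f Y"
    and variance_integrable:
      "\<And>Y. integrable D (\<lambda>z. (norm (grad (\<lambda>Y'. F Y' z) Y - grad f Y))\<^sup>2)"
    and variance:
      "\<And>Y. (\<integral>z. (norm (grad (\<lambda>Y'. F Y' z) Y - grad f Y))\<^sup>2 \<partial>D) \<le> \<sigma>\<^sup>2"
    \<comment> \<open>i.i.d. samples from \<open>D\<close>\<close>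
    and P_prob: "prob_space P"
    and xi_indep: "prob_space.indep_vars P (\<lambda>_. D) \<xi> {1..}"
    and xi_distr: "\<And>t. t \<ge> 1 \<Longrightarrow> distr P D (\<xi> t) = D"
    \<comment> \<open>parameters and iterates\<close>
    and eta_def: "\<And>t. t \<ge> 1 \<Longrightarrow> \<eta> t = real t powr (- 3 / 4)"
    and beta_def: "\<And>t. t \<ge> 1 \<Longrightarrow> \<beta> t = 1 - real t powr (- 1 / 2)"
    and a_def: "a = 0.2 * sqrt (max m n)"
    and M_0: "\<And>\<omega>. \<omega> \<in> space P \<Longrightarrow> M 0 \<omega> = 0"
    and X_1: "\<And>\<omega>. \<omega> \<in> space P \<Longrightarrow> X 1 \<omega> = X\<^sub>1"
    and G_step: "\<And>t \<omega>. t \<ge> 1 \<Longrightarrow> \<omega> \<in> space P \<Longrightarrow>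
      G t \<omega> = grad (\<lambda>Y. F Y (\<xi> t \<omega>)) (X t \<omega>)"
    and M_step: "\<And>t \<omega>. t \<ge> 1 \<Longrightarrow> \<omega> \<in> space P \<Longrightarrow>
      M t \<omega> = \<beta> t *\<^sub>R M (t - 1) \<omega> + (1 - \<beta> t) *\<^sub>R G t \<omega>"
    and Q_step: "\<And>t \<omega>. t \<ge> 1 \<Longrightarrow> \<omega> \<in> space P \<Longrightarrow>
      Q t \<omega> = Orth (diag_inv_sqrt (D_row \<epsilon> (M t \<omega>)) ** M t \<omega> ** diag_inv_sqrt (D_col \<epsilon> (M t \<omega>)))"
    and X_step: "\<And>t \<omega>. t \<ge> 1 \<Longrightarrow> \<omega> \<in> space P \<Longrightarrow>
      X (t + 1) \<omega> = X t \<omega> - (a * \<eta> t) *\<^sub>R Q t \<omega>"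
    \<comment> \<open>almost surely bounded stochastic gradients\<close>
    and G_inf_pos: "G_inf > 0"
    and G_bounded: "\<And>t. t \<ge> 1 \<Longrightarrow> AE \<omega> in P. infnorm (G t \<omega>) \<le> G_inf"
    and eps_ge: "\<epsilon> \<ge> 4 / 5 * G_inf\<^sup>2 * max m n"
    \<comment> \<open>constants\<close>
    and rho_r_def: "\<rho>\<^sub>r = sqrt (1 + n * G_inf\<^sup>2 / \<epsilon>)"
    and rho_c_def: "\<rho>\<^sub>c = sqrt (1 + m * G_inf\<^sup>2 / \<epsilon>)"
    and chi_def: "\<chi>\<^sub>\<epsilon> = (\<rho>\<^sub>r + 1) * (\<rho>\<^sub>c + 1) / (4 * \<rho>\<^sub>r * \<rho>\<^sub>c)
      - (3 * \<rho>\<^sub>r * \<rho>\<^sub>c - \<rho>\<^sub>r - \<rho>\<^sub>c - 1) / 4"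
    and C1_def: "C\<^sub>1 = a / L * (2 * sqrt 2 * L\<^sup>2 * a\<^sup>2 * n + \<sigma>\<^sup>2)
      + a * L * (\<chi>\<^sub>\<epsilon> + \<rho>\<^sub>r * \<rho>\<^sub>c * sqrt n)\<^sup>2"
    and C2_def: "C\<^sub>2 = a * \<sigma>\<^sup>2 / L + 3 * L * a\<^sup>2 * n / 2"
  shows "\<rho>\<^sub>r \<le> 3 / 2 \<and> \<rho>\<^sub>c \<le> 3 / 2 \<and> \<chi>\<^sub>\<epsilon> \<ge> 1 / 144 \<and>
    (\<forall>t\<ge>1. integrable P (\<lambda>\<omega>. norm (grad f (X t \<omega>)))) \<and>
    (\<forall>T::nat. T \<ge> 1 \<longrightarrow>
      1 / real T * (\<Sum>t=1..T. \<integral>\<omega>. norm (grad f (X t \<omega>)) \<partial>P)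
        \<le> (f X\<^sub>1 - f_star + C\<^sub>1 * (1 + ln (real T)) + C\<^sub>2) / (a * \<chi>\<^sub>\<epsilon> * real T powr (1 / 4)))"
proof -
  note One_nat_def [simp del]
  have mn: "1 \<le> n" "1 \<le> m" "n \<le> m"
    using m_ge_n by (simp_all add: m_def n_def One_nat_def Suc_le_eq)
  have max_mn: "max m n = m"
    using mn by simp
  have \<epsilon>_pos: "\<epsilon> > 0"
    using G_inf_pos mn by (intro less_le_trans[OF _ eps_ge]) (simp add: max_mn)
  have \<epsilon>_ge: "4 / 5 * (m * G_inf\<^sup>2) \<le> \<epsilon>"
    using eps_ge by (simp add: max_mn mult_ac)
  have \<rho>r: "1 \<le> \<rho>\<^sub>r" "\<rho>\<^sub>r \<le> 3 / 2"
    unfolding rho_r_def using mn by (intro sqrt_one_plus_bounds[OF \<epsilon>_ge \<epsilon>_pos]; auto intro: mult_right_mono)+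
  have \<rho>c: "1 \<le> \<rho>\<^sub>c" "\<rho>\<^sub>c \<le> 3 / 2"
    unfolding rho_c_def using mn by (intro sqrt_one_plus_bounds[OF \<epsilon>_ge \<epsilon>_pos]; auto)+
  note \<chi>_bounds = chi_bounds[OF \<rho>r \<rho>c, folded chi_def]
  have \<chi>_pos: "\<chi>\<^sub>\<epsilon> > 0"
    using \<chi>_bounds(1) by linarith
  have a_pos: "a > 0"
    using mn by (simp add: a_def max_mn)

  let ?g = "\<lambda>Y z. grad (\<lambda>Y'. F Y' z) Y"
  let ?dir = "\<lambda>M. Orth (precondition \<epsilon> M)"
  let ?S = "{A :: real ^ 'n ^ 'm. infnorm A \<le> G_inf}"
  interpret P: prob_space P by (rule P_prob)
  interpret D: prob_space D by (rule D_prob)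
  \<comment> \<open>The step length is \<open>a * \<eta> t\<close>, and the direction bound
    \<open>sqrt n\<close> is the norm bound for \<open>Orth\<close>.\<close>
  interpret momentum_iterates P D ?g "grad f" \<xi> X M ?dir X\<^sub>1 "\<lambda>t. a * \<eta> t" \<beta> L \<sigma> "sqrt n" ?S
  proof (unfold_locales, goal_cases)
    case 1
    show ?case
      using F_integrable F_diff by (intro borel_measurable_grad_pair) auto
  next
    case (9 t)
    then show ?case by (simp add: beta_def powr_minus_divide ge_one_powr_ge_zero)
  next
    case (10 t)
    then show ?case by (simp add: beta_def)
  next
    case (13 t \<omega>)
    then show ?case using M_step G_step by simp
  next
    case (14 t \<omega>)
    then show ?case using X_step Q_step by (simp add: precondition_def)
  next
    case 15
    show ?case
      by (rule measurable_compose[OF borel_measurable_precondition[OF \<epsilon>_pos] borel_measurable_Orth])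
  next
    case 16
    show ?case using norm_Orth_le by (simp add: n_def)
  next
    case 17
    show ?case by (rule convex_infnorm_le)
  next
    case 18
    show ?case by (rule bounded_infnorm_le)
  next
    case 19
    show ?case using G_inf_pos by (simp add: infnorm_0)
  next
    case (20 t)
    from G_bounded[OF 20] AE_space show ?case
      by eventually_elim (simp add: G_step[OF 20])
  qed (use L_pos smooth grad_integrable unbiased variance xi_indep xi_distr M_0 X_1 in auto)

  define e where "e t = (\<integral>\<omega>. (norm (M t \<omega> - grad f (X t \<omega>)))\<^sup>2 \<partial>P)" for t
  define K where "K = 2 * sqrt 2 * L\<^sup>2 * a\<^sup>2 * n + \<sigma>\<^sup>2"
  define c where "c = \<chi>\<^sub>\<epsilon> + \<rho>\<^sub>r * \<rho>\<^sub>c * sqrt n"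
  have c_pos: "0 \<le> c"
    using \<chi>_pos \<rho>r \<rho>c mn by (simp add: c_def)
  have K_nonneg: "0 \<le> K"
    using mn by (simp add: K_def)
  have eta_sq: "(\<eta> t)\<^sup>2 = real t powr (- 3 / 2)" if "t \<ge> 1" for t
    using that by (simp add: eta_def power2_eq_square powr_add[symmetric])

  have e_nonneg: "0 \<le> e t" for t
    by (simp add: e_def)
  \<comment> \<open>Since \<open>\<beta> 1 = 0\<close>, the initial momentum is forgotten and the
    first error is that of a single sample.\<close>
  have e_1: "e 1 \<le> \<sigma>\<^sup>2"
    using expectation_momentum_error_le[of 1] by (simp add: e_def beta_def)
  \<comment> \<open>The squared drift has order \<open>t powr (- 3 / 2)\<close> and is divided by
    \<open>t powr (- 1 / 2)\<close>, while the noise carries the square of the latter; both are of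
    order 1/t.\<close>
  have e_rec: "e t \<le> (1 - real t powr (- 1 / 2)) * e (t - 1) + K / real t" if t: "t \<ge> 2" for t
  proof -
    let ?\<alpha> = "real t powr (- 1 / 2)"
    have t': "t \<ge> 1" "t - 1 \<ge> 1" "real t > 0"
      using t by auto
    have \<alpha>_sq: "?\<alpha>\<^sup>2 = 1 / real t"
      using t' by (simp add: power2_eq_square powr_add[symmetric] powr_minus_divide)
    have "(L * (a * \<eta> (t - 1)) * sqrt n)\<^sup>2 / ?\<alpha> = L\<^sup>2 * a\<^sup>2 * n * (real (t - 1) powr (- 3 / 2) / ?\<alpha>)"
      using mn eta_sq[OF t'(2)] by (simp add: power_mult_distrib)
    also have "\<dots> \<le> L\<^sup>2 * a\<^sup>2 * n * (2 * sqrt 2 * real t powr (- 3 / 2) / ?\<alpha>)"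
      using mn powr_pred_le[OF t] by (intro mult_left_mono divide_right_mono) auto
    also have "\<dots> = L\<^sup>2 * a\<^sup>2 * n * (2 * sqrt 2 * (real t powr (- 3 / 2 - - 1 / 2)))"
      by (simp only: powr_diff times_divide_eq_right)
    also have "\<dots> = 2 * sqrt 2 * L\<^sup>2 * a\<^sup>2 * n / real t"
      using t' by (simp add: powr_minus_divide)
    finally have "(L * (a * \<eta> (t - 1)) * sqrt n)\<^sup>2 / ?\<alpha> + ?\<alpha>\<^sup>2 * \<sigma>\<^sup>2 \<le> K / real t"
      unfolding \<alpha>_sq K_def add_divide_distrib by simp
    moreover have "e t \<le> (1 - ?\<alpha>) * e (t - 1) + (L * (a * \<eta> (t - 1)) * sqrt n)\<^sup>2 / ?\<alpha> + ?\<alpha>\<^sup>2 * \<sigma>\<^sup>2"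
      unfolding e_def
      by (rule expectation_momentum_error_recursion[OF t]) (use t' in \<open>auto simp: beta_def\<close>)
    ultimately show ?thesis
      by linarith
  qed

  have descent: "a * \<eta> t * \<chi>\<^sub>\<epsilon> * norm (grad f (X t \<omega>)) \<le> f (X t \<omega>) - f (X (t + 1) \<omega>)
      + (a * L * c\<^sup>2 / 2 * (1 / real t)
        + a / (2 * L) * (real t powr (- 1 / 2) * (norm (M t \<omega> - grad f (X t \<omega>)))\<^sup>2)
        + L * a\<^sup>2 * n / 2 * real t powr (- 3 / 2))"
    if t: "t \<ge> 1" and \<omega>: "\<omega> \<in> space P" and M_le: "infnorm (M t \<omega>) \<le> G_inf" for t \<omega>
  proof -
    let ?x = "X t \<omega>" and ?M = "M t \<omega>"
    define W where "W = ?dir ?M"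
    define h where "h = grad f ?x"
    define E where "E = norm (?M - h)"
    have \<eta>_pos: "\<eta> t > 0"
      using t by (simp add: eta_def)
    have x': "X (t + 1) \<omega> - ?x = - (a * \<eta> t) *\<^sub>R W"
      using X_step[OF t \<omega>] Q_step[OF t \<omega>] by (simp add: W_def precondition_def)
    have nW: "norm W \<le> sqrt n"
      unfolding W_def n_def by (rule norm_Orth_le)
    have "\<chi>\<^sub>\<epsilon> * norm ?M \<le> ((\<rho>\<^sub>r + 1) * (\<rho>\<^sub>c + 1) / 2 - \<rho>\<^sub>r * \<rho>\<^sub>c) / (\<rho>\<^sub>r * \<rho>\<^sub>c) * norm ?M"
      using \<chi>_bounds(3) by (intro mult_right_mono) auto
    also have "\<dots> \<le> ?M \<bullet> W"
      unfolding W_def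
      by (rule precondition_alignment[where g = G_inf, OF \<epsilon>_pos])
        (use infnorm_matrix_nth_le[of ?M] M_le \<chi>_bounds(2)
         in \<open>auto simp: rho_r_def rho_c_def n_def m_def intro: order_trans\<close>)
    finally have MW: "\<chi>\<^sub>\<epsilon> * norm ?M \<le> ?M \<bullet> W" .
    have "norm h \<le> norm ?M + E"
      using norm_triangle_sub[of h ?M] by (simp add: E_def norm_minus_commute)
    then have "\<chi>\<^sub>\<epsilon> * norm h \<le> \<chi>\<^sub>\<epsilon> * (norm ?M + E)"
      using \<chi>_pos by (intro mult_left_mono) auto
    moreover have "(?M - h) \<bullet> W \<le> sqrt n * E"
      using norm_cauchy_schwarz[of "?M - h" W] mult_left_mono[OF nW norm_ge_zero[of "?M - h"]]
      by (simp add: E_def mult.commute)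
    \<comment> \<open>Enlarging the coefficient of \<open>E\<close> by
      \<open>\<rho>\<^sub>r * \<rho>\<^sub>c \<ge> 1\<close> brings it to the form \<open>c\<close>
      that appears in \<open>C\<^sub>1\<close>.\<close>
    moreover have "1 * (sqrt n * E) \<le> \<rho>\<^sub>r * \<rho>\<^sub>c * (sqrt n * E)"
      using \<rho>r \<rho>c mn mult_mono[of 1 "\<rho>\<^sub>r" 1 "\<rho>\<^sub>c"] by (intro mult_right_mono) (auto simp: E_def)
    ultimately have hW: "\<chi>\<^sub>\<epsilon> * norm h - c * E \<le> h \<bullet> W"
      using MW by (simp add: c_def algebra_simps)
    have "(norm W)\<^sup>2 \<le> n"
      using power_mono[OF nW norm_ge_zero, of 2] mn by simp
    have "f (X (t + 1) \<omega>) \<le> f ?x + h \<bullet> (X (t + 1) \<omega> - ?x) + L / 2 * (norm (X (t + 1) \<omega> - ?x))\<^sup>2"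
      unfolding h_def by (rule descent_lemma[OF f_diff smooth])
    also have "\<dots> = f ?x - (a * \<eta> t) * (h \<bullet> W) + L / 2 * ((a * \<eta> t)\<^sup>2 * (norm W)\<^sup>2)"
      by (simp add: x' power_mult_distrib)
    also have "\<dots> \<le> f ?x - (a * \<eta> t) * (\<chi>\<^sub>\<epsilon> * norm h - c * E) + L / 2 * ((a * \<eta> t)\<^sup>2 * n)"
      using hW \<open>(norm W)\<^sup>2 \<le> n\<close> a_pos \<eta>_pos L_pos
      by (intro add_mono diff_left_mono mult_left_mono) auto
    also have "\<dots> = f ?x - a * \<eta> t * \<chi>\<^sub>\<epsilon> * norm h + a * (\<eta> t * c * E) + L * a\<^sup>2 * n / 2 * (\<eta> t)\<^sup>2"
      by (simp add: power_mult_distrib algebra_simps)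
    also have "a * (\<eta> t * c * E) \<le>
        a * (L * c\<^sup>2 / 2 * (1 / real t) + 1 / (2 * L) * (real t powr (- 1 / 2) * E\<^sup>2))"
      using Young_step_size[OF L_pos t, of c E] a_pos by (intro mult_left_mono) (auto simp: eta_def[OF t])
    finally show ?thesis
      by (simp add: eta_sq[OF t] E_def h_def algebra_simps)
  qed

  have int_h: "integrable P (\<lambda>\<omega>. norm (grad f (X t \<omega>)))" if "t \<ge> 1" for t
    using that by (rule integrable_norm_h_X)
  have rate: "1 / real T * (\<Sum>t=1..T. \<integral>\<omega>. norm (grad f (X t \<omega>)) \<partial>P)
      \<le> (f X\<^sub>1 - f_star + C\<^sub>1 * (1 + ln (real T)) + C\<^sub>2) / (a * \<chi>\<^sub>\<epsilon> * real T powr (1 / 4))"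
    if T: "T \<ge> 1" for T
  proof -
    define N where "N t = (\<integral>\<omega>. norm (grad f (X t \<omega>)) \<partial>P)" for t
    let ?b = "\<lambda>t \<omega>. a * L * c\<^sup>2 / 2 * (1 / real t)
        + a / (2 * L) * (real t powr (- 1 / 2) * (norm (M t \<omega> - grad f (X t \<omega>)))\<^sup>2)
        + L * a\<^sup>2 * n / 2 * real t powr (- 3 / 2)"
    let ?B = "f X\<^sub>1 - f_star + C\<^sub>1 * (1 + ln (real T)) + C\<^sub>2"
    have ln_nonneg: "0 \<le> ln (real T)"
      using T by simp
    \<comment> \<open>The exceptional null sets of the countably many times are merged, so that one
      path satisfies the descent inequality at all times.\<close>
    have "AE \<omega> in P. \<forall>t. infnorm (M t \<omega>) \<le> G_inf"
      using M_in_S by (simp add: AE_all_countable)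
    then have AE: "AE \<omega> in P. (\<Sum>t=1..T. a * \<eta> t * \<chi>\<^sub>\<epsilon> * norm (grad f (X t \<omega>)))
        \<le> f X\<^sub>1 - f_star + (\<Sum>t=1..T. ?b t \<omega>)"
      using AE_space
    proof eventually_elim
      case (elim \<omega>)
      have "(\<Sum>t=1..T. a * \<eta> t * \<chi>\<^sub>\<epsilon> * norm (grad f (X t \<omega>)))
          \<le> (\<Sum>t=1..T. (f (X t \<omega>) - f (X (t + 1) \<omega>)) + ?b t \<omega>)"
        using descent elim by (intro sum_mono) auto
      also have "\<dots> = (\<Sum>t=1..T. f (X t \<omega>) - f (X (t + 1) \<omega>)) + (\<Sum>t=1..T. ?b t \<omega>)"
        by (rule sum.distrib)
      also have "(\<Sum>t=1..T. f (X t \<omega>) - f (X (t + 1) \<omega>)) = f (X 1 \<omega>) - f (X (T + 1) \<omega>)"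
        using sum_Suc_diff[of 1 T "\<lambda>t. - f (X t \<omega>)"] T by (simp flip: Suc_eq_plus1)
      also have "\<dots> \<le> f X\<^sub>1 - f_star"
        using f_bounded_below[of "X (T + 1) \<omega>"] X_1 elim(2) by simp
      finally show ?case
        by simp
    qed
    have int_e: "integrable P (\<lambda>\<omega>. (norm (M t \<omega> - grad f (X t \<omega>)))\<^sup>2)" if "t \<in> {1..T}" for t
      using that by (intro integrable_momentum_error_sq) auto
    have int_b: "integrable P (?b t)" if "t \<in> {1..T}" for t
      using int_e[OF that] by simp
    have "(\<Sum>t=1..T. a * \<eta> t * \<chi>\<^sub>\<epsilon> * N t) =
        (\<integral>\<omega>. (\<Sum>t=1..T. a * \<eta> t * \<chi>\<^sub>\<epsilon> * norm (grad f (X t \<omega>))) \<partial>P)"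
      unfolding N_def using int_h by (subst Bochner_Integration.integral_sum) auto
    also have "\<dots> \<le> (\<integral>\<omega>. f X\<^sub>1 - f_star + (\<Sum>t=1..T. ?b t \<omega>) \<partial>P)"
      using AE by (intro integral_mono_AE Bochner_Integration.integrable_add
          Bochner_Integration.integrable_sum int_b) (use int_h in auto)
    also have "\<dots> = f X\<^sub>1 - f_star + (\<Sum>t=1..T. \<integral>\<omega>. ?b t \<omega> \<partial>P)"
    proof -
      have "integrable P (\<lambda>\<omega>. \<Sum>t=1..T. ?b t \<omega>)"
        by (intro Bochner_Integration.integrable_sum int_b)
      then have "(\<integral>\<omega>. f X\<^sub>1 - f_star + (\<Sum>t=1..T. ?b t \<omega>) \<partial>P) =
          (\<integral>\<omega>. f X\<^sub>1 - f_star \<partial>P) + (\<integral>\<omega>. (\<Sum>t=1..T. ?b t \<omega>) \<partial>P)"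
        by (intro Bochner_Integration.integral_add) simp_all
      moreover have "(\<integral>\<omega>. (\<Sum>t=1..T. ?b t \<omega>) \<partial>P) = (\<Sum>t=1..T. \<integral>\<omega>. ?b t \<omega> \<partial>P)"
        by (intro Bochner_Integration.integral_sum int_b)
      ultimately show ?thesis
        by (simp only: lebesgue_integral_const P.prob_space scaleR_one)
    qed
    also have "(\<Sum>t=1..T. \<integral>\<omega>. ?b t \<omega> \<partial>P) = (\<Sum>t=1..T. a * L * c\<^sup>2 / 2 * (1 / real t)
        + a / (2 * L) * (real t powr (- 1 / 2) * e t) + L * a\<^sup>2 * n / 2 * real t powr (- 3 / 2))"
      using int_e by (intro sum.cong) (simp_all add: e_def P.prob_space)
    also have "\<dots> = a * L * c\<^sup>2 / 2 * (\<Sum>t=1..T. 1 / real t)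
        + a / (2 * L) * (\<Sum>t=1..T. real t powr (- 1 / 2) * e t)
        + L * a\<^sup>2 * n / 2 * (\<Sum>t=1..T. real t powr (- 3 / 2))"
      by (simp only: sum.distrib sum_distrib_left)
    also have "f X\<^sub>1 - f_star + \<dots> \<le> ?B"
    proof -
      have "a * L * c\<^sup>2 / 2 * (\<Sum>t=1..T. 1 / real t) \<le> a * L * c\<^sup>2 / 2 * (1 + ln (real T))"
        using harm_le_ln[OF T] a_pos L_pos by (intro mult_left_mono) auto
      \<comment> \<open>The stated \<open>C\<^sub>1\<close> leaves room for dropping the factor 1/2
        from Young's inequality; the error term below needs only
        \<open>sqrt 2 / 2 \<le> 1\<close>.\<close>
      also have "\<dots> \<le> a * L * c\<^sup>2 * (1 + ln (real T))"
        using a_pos L_pos ln_nonneg by (intro mult_right_mono) auto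
      finally have 1: "a * L * c\<^sup>2 / 2 * (\<Sum>t=1..T. 1 / real t) \<le> a * L * c\<^sup>2 * (1 + ln (real T))" .
      have "a / (2 * L) * (\<Sum>t=1..T. real t powr (- 1 / 2) * e t) \<le>
          a / (2 * L) * (sqrt 2 * (\<sigma>\<^sup>2 + K * (1 + ln (real T))))"
        using a_pos L_pos
        by (intro mult_left_mono weighted_error_sum_le[OF e_nonneg e_1 K_nonneg e_rec T]) auto
      also have "\<dots> = a / L * (\<sigma>\<^sup>2 + K * (1 + ln (real T))) * (sqrt 2 / 2)"
        by (simp add: mult_ac)
      also have "\<dots> \<le> a / L * (\<sigma>\<^sup>2 + K * (1 + ln (real T))) * 1"
        using a_pos L_pos K_nonneg ln_nonneg sqrt2_less_2 by (intro mult_left_mono) auto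
      finally have 2: "a / (2 * L) * (\<Sum>t=1..T. real t powr (- 1 / 2) * e t) \<le>
          a / L * (\<sigma>\<^sup>2 + K * (1 + ln (real T)))"
        by simp
      have "(\<Sum>t=1..T. real t powr (- 3 / 2)) \<le> 3"
        using power_three_halves_sum_le[OF T] by (rule order_trans) simp
      then have "L * a\<^sup>2 * n / 2 * (\<Sum>t=1..T. real t powr (- 3 / 2)) \<le> L * a\<^sup>2 * n / 2 * 3"
        using L_pos mn by (intro mult_left_mono) auto
      with 1 2 have "f X\<^sub>1 - f_star + (a * L * c\<^sup>2 / 2 * (\<Sum>t=1..T. 1 / real t)
          + a / (2 * L) * (\<Sum>t=1..T. real t powr (- 1 / 2) * e t)
          + L * a\<^sup>2 * n / 2 * (\<Sum>t=1..T. real t powr (- 3 / 2)))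
        \<le> f X\<^sub>1 - f_star + (a * L * c\<^sup>2 * (1 + ln (real T)) + a / L * (\<sigma>\<^sup>2 + K * (1 + ln (real T)))
          + L * a\<^sup>2 * n / 2 * 3)"
        by (intro add_left_mono add_mono)
      also have "\<dots> = ?B"
        unfolding C1_def C2_def c_def[symmetric] K_def[symmetric] by (simp add: algebra_simps add_divide_distrib)
      finally show ?thesis .
    qed
    finally have sum_le: "(\<Sum>t=1..T. a * \<eta> t * \<chi>\<^sub>\<epsilon> * N t) \<le> ?B" .
    \<comment> \<open>The step sizes decrease, so the last one bounds all of them from below;
      dividing by \<open>T\<close> turns its exponent -3/4 into the rate 1/4.\<close>
    have "a * \<chi>\<^sub>\<epsilon> * real T powr (- 3 / 4) * (\<Sum>t=1..T. N t) \<le> (\<Sum>t=1..T. a * \<eta> t * \<chi>\<^sub>\<epsilon> * N t)"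
      unfolding sum_distrib_left
    proof (rule sum_mono)
      fix t assume t: "t \<in> {1..T}"
      then have "real T powr (- 3 / 4) \<le> \<eta> t"
        by (simp add: eta_def) (intro powr_mono2', auto)
      then have "(a * \<chi>\<^sub>\<epsilon> * N t) * real T powr (- 3 / 4) \<le> (a * \<chi>\<^sub>\<epsilon> * N t) * \<eta> t"
        using a_pos \<chi>_pos by (intro mult_left_mono) (auto simp: N_def)
      then show "a * \<chi>\<^sub>\<epsilon> * real T powr (- 3 / 4) * N t \<le> a * \<eta> t * \<chi>\<^sub>\<epsilon> * N t"
        by (simp add: mult_ac)
    qed
    also note sum_le
    also have "real T powr (- 3 / 4) = real T powr (1 / 4) * (1 / real T)"
    proof -
      have "real T powr (- 3 / 4) = real T powr (1 / 4 - 1)"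
        by simp
      then show ?thesis
        using T by (simp only: powr_diff) simp
    qed
    finally have "1 / real T * (\<Sum>t=1..T. N t) * (a * \<chi>\<^sub>\<epsilon> * real T powr (1 / 4)) \<le> ?B"
      by (simp add: mult_ac)
    then show ?thesis
      using a_pos \<chi>_pos T by (simp add: N_def pos_le_divide_eq)
  qed
  show ?thesis
    using \<rho>r(2) \<rho>c(2) \<chi>_bounds(1) int_h rate by blast
qed

end
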